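(* Let $H$ be a complex Hilbert space, let $I\subseteq\mathbb{R}$ be an interval and let $f:I\to\mathbb{R}^+=[0,\infty)$ be continuous. Let $S\subseteq B(H)_{sa}$ be an open invex set with respect to $\eta:S\times S\to B(H)_{sa}$, and suppose that $\eta$ satisfies condition $C$. Suppose that for every $A,B\in S$ and $V=A+\eta(B,A)$, the spectra of $A$ and $V$ are contained in $I$ and $f$ is operator preinvex with respect to $\eta$ on the $\eta$-path $P_{AV}$. Then for every $A,B\in S$, every $a,b\in(0,1)$ with $a<b$ and every $x\in H$ with $\|x\|=1$, $$\left|\frac{1}{2}\left\langle\int_0^a f(A+s\eta(B,A))ds\,x,x\right\rangle +\frac{1}{2}\left\langle\int_0^b f(A+s\eta(B,A))ds\,x,x\right\rangle-\frac{1}{b-a}\int_a^b\left\langle\int_0^t f(A+s\eta(B,A))ds\,x,x\right\rangle dt\right|$$ $$\leq \frac{b-a}{8} \left\{\langle f(A+a\eta(B,A))x,x\rangle+ \langle f(A+b\eta(B,A))x,x\rangle\right\}.$$ Moreover, $$\left\|\frac{1}{2}\int_0^a f(A+s\eta(B,A))ds +\frac{1}{2}\int_0^b f(A+s\eta(B,A))ds-\frac{1}{b-a}\int_a^b\int_0^t f(A+s\eta(B,A))\,ds\, dt \right\|$$ $$\leq \frac{b-a}{8} \left\| f(A+a\eta(B,A))+ f(A+b\eta(B,A))\right\|\leq \frac{b-a}{8}\left[\, \| f(A+a\eta(B,A))\|+\|f(A+b\eta(B,A))\|\,\right].$$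
   Context: $B(H)_{sa}$ denotes the set of bounded selfadjoint operators on $H$. For a bounded selfadjoint operator $A$ and a real continuous function $f$ on an interval containing the spectrum of $A$, $f(A)$ is defined by the continuous functional calculus. The operator order is: $X\le Y$ iff $Y-X$ is a positive operator. Integrals of operator-valued functions are integrals of norm-continuous functions with values in $B(H)$; $\|\cdot\|$ of an operator is the operator norm. Invex set: a subset $S$ of a real vector space $X$ is invex with respect to a map $\eta:S\times S\to X$ if $y+t\eta(x,y)\in S$ for all $x,y\in S$ and $t\in[0,1]$. Condition $C$: for all $x,y\in S$ and $t\in[0,1]$, $\eta(y,y+t\eta(x,y))=-t\eta(x,y)$ and $\eta(x,y+t\eta(x,y))=(1-t)\eta(x,y)$. $\eta$-path: for $A,B\in S$ and $V=A+\eta(B,A)$, $P_{AV}=\{A+t\eta(B,A): t\in[0,1]\}$. Operator preinvex: a continuous real function $f$ (defined on an interval containing the spectra of all operators involved) is operator preinvex with respect to $\eta$ on a set $S'\subseteq S$ if for every $C,D\in S'$ and $t\in[0,1]$, $f(C+t\eta(D,C))\leq (1-t)f(C)+tf(D)$ in the operator order. *)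

theory Defs
  imports "HOL-Analysis.Analysis"
begin

section \<open>Complex Hilbert spaces\<close>

class scaleC = scaleR +
  fixes scaleC :: "complex \<Rightarrow> 'a \<Rightarrow> 'a" (infixr \<open>*\<^sub>C\<close> 75)
  assumes scaleR_scaleC: "r *\<^sub>R x = complex_of_real r *\<^sub>C x"

class complex_vector = scaleC + ab_group_add +
  assumes scaleC_add_right: "a *\<^sub>C (x + y) = a *\<^sub>C x + a *\<^sub>C y"
    and scaleC_add_left: "(a + b) *\<^sub>C x = a *\<^sub>C x + b *\<^sub>C x"
    and scaleC_scaleC: "a *\<^sub>C (b *\<^sub>C x) = (a * b) *\<^sub>C x"
    and scaleC_one: "1 *\<^sub>C x = x"

class complex_inner = complex_vector + real_normed_vector +
  fixes cinner :: "'a \<Rightarrow> 'a \<Rightarrow> complex"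
  assumes cinner_commute: "cinner x y = cnj (cinner y x)"
    and cinner_add_left: "cinner (x + y) z = cinner x z + cinner y z"
    and cinner_scaleC_left: "cinner (c *\<^sub>C x) y = c * cinner x y"
    and cinner_ge_zero: "0 \<le> Re (cinner x x)"
    and cinner_eq_zero_iff: "cinner x x = 0 \<longleftrightarrow> x = 0"
    and norm_eq_sqrt_cinner: "norm x = sqrt (Re (cinner x x))"

class chilbert_space = complex_inner + complete_space

text \<open>Makes the real-linear operator space \<open>'h \<Rightarrow>\<^sub>L 'h\<close> an instance of \<open>banach\<close>.\<close>

subclass (in chilbert_space) banach ..


section \<open>Bounded operators\<close>

text \<open>
  The library type \<open>'h \<Rightarrow>\<^sub>L 'h\<close> consists of the bounded \<^emph>\<open>real\<close>-linear maps.  $B(H)$ is the closed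
  subspace of complex-linear ones; the norm of that type is the operator norm.
\<close>

definition BH :: "('h::chilbert_space \<Rightarrow>\<^sub>L 'h) set" where
  "BH = {T. \<forall>c x. blinfun_apply T (c *\<^sub>C x) = c *\<^sub>C blinfun_apply T x}"

definition BH_sa :: "('h::chilbert_space \<Rightarrow>\<^sub>L 'h) set" where
  "BH_sa = {T \<in> BH. \<forall>x y. cinner (blinfun_apply T x) y = cinner x (blinfun_apply T y)}"

definition positive_op :: "('h::chilbert_space \<Rightarrow>\<^sub>L 'h) \<Rightarrow> bool" where
  "positive_op T \<longleftrightarrow> T \<in> BH \<and> (\<forall>x. cinner (blinfun_apply T x) x \<in> \<real>\<^sub>\<ge>\<^sub>0)"

definition op_le :: "('h::chilbert_space \<Rightarrow>\<^sub>L 'h) \<Rightarrow> ('h \<Rightarrow>\<^sub>L 'h) \<Rightarrow> bool" (infix \<open>\<le>\<^sub>o\<^sub>p\<close> 50) where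
  "X \<le>\<^sub>o\<^sub>p Y \<longleftrightarrow> positive_op (Y - X)"

definition spectrum :: "('h::chilbert_space \<Rightarrow>\<^sub>L 'h) \<Rightarrow> complex set" where
  "spectrum A = {z. \<not> (\<exists>R\<in>BH. \<forall>x.
      blinfun_apply R (blinfun_apply A x - z *\<^sub>C x) = x \<and>
      blinfun_apply A (blinfun_apply R x) - z *\<^sub>C blinfun_apply R x = x)}"


section \<open>Continuous functional calculus\<close>

text \<open>
  \<open>Phi\<close> is the isometric unital *-homomorphism from $C(\sigma(A))$ to $B(H)$ that maps the identity
  function to \<open>A\<close>.  Elements of $C(\sigma(A))$ are represented by functions on \<open>complex\<close> that are
  continuous on the spectrum; the isometry clause applied to differences makes \<open>Phi f\<close> depend only
  on the restriction of \<open>f\<close> to the spectrum.  Inserting \<open>0\<close> leaves the supremum norm unchanged and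
  gives it the right value on the empty spectrum of the zero space.
\<close>

definition is_functional_calculus ::
    "('h::chilbert_space \<Rightarrow>\<^sub>L 'h) \<Rightarrow> ((complex \<Rightarrow> complex) \<Rightarrow> ('h \<Rightarrow>\<^sub>L 'h)) \<Rightarrow> bool" where
  "is_functional_calculus A Phi \<longleftrightarrow>
    (\<forall>f. continuous_on (spectrum A) f \<longrightarrow>
       Phi f \<in> BH \<and>
       (\<forall>x y. cinner (blinfun_apply (Phi f) x) y = cinner x (blinfun_apply (Phi (\<lambda>z. cnj (f z))) y)) \<and>
       norm (Phi f) = Sup (insert 0 ((\<lambda>z. cmod (f z)) ` spectrum A))) \<and>
    (\<forall>f g. continuous_on (spectrum A) f \<longrightarrow> continuous_on (spectrum A) g \<longrightarrow>
       (\<forall>\<alpha> \<beta> x. blinfun_apply (Phi (\<lambda>z. \<alpha> * f z + \<beta> * g z)) x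
          = \<alpha> *\<^sub>C blinfun_apply (Phi f) x + \<beta> *\<^sub>C blinfun_apply (Phi g) x) \<and>
       Phi (\<lambda>z. f z * g z) = Phi f o\<^sub>L Phi g) \<and>
    Phi (\<lambda>z. 1) = id_blinfun \<and>
    Phi (\<lambda>z. z) = A"

text \<open>
  \<open>fun_op f A\<close> is $f(A)$ for selfadjoint \<open>A\<close> (whose spectrum is real) and real \<open>f\<close> continuous on the
  spectrum.
\<close>

definition fun_op :: "(real \<Rightarrow> real) \<Rightarrow> ('h::chilbert_space \<Rightarrow>\<^sub>L 'h) \<Rightarrow> ('h \<Rightarrow>\<^sub>L 'h)" where
  "fun_op f A =
    (THE T. \<exists>Phi. is_functional_calculus A Phi \<and> T = Phi (\<lambda>z. complex_of_real (f (Re z))))"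


section \<open>Invexity and operator preinvexity\<close>

definition invex :: "'v::real_vector set \<Rightarrow> ('v \<Rightarrow> 'v \<Rightarrow> 'v) \<Rightarrow> bool" where
  "invex S \<eta> \<longleftrightarrow> (\<forall>x\<in>S. \<forall>y\<in>S. \<forall>t\<in>{0..1}. y + t *\<^sub>R \<eta> x y \<in> S)"

definition condition_C :: "'v::real_vector set \<Rightarrow> ('v \<Rightarrow> 'v \<Rightarrow> 'v) \<Rightarrow> bool" where
  "condition_C S \<eta> \<longleftrightarrow> (\<forall>x\<in>S. \<forall>y\<in>S. \<forall>t\<in>{0..1}.
      \<eta> y (y + t *\<^sub>R \<eta> x y) = - (t *\<^sub>R \<eta> x y) \<and>
      \<eta> x (y + t *\<^sub>R \<eta> x y) = (1 - t) *\<^sub>R \<eta> x y)"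

text \<open>The path $P_{AV}$ with $V = A + \eta(B,A)$.\<close>

definition eta_path :: "('v::real_vector \<Rightarrow> 'v \<Rightarrow> 'v) \<Rightarrow> 'v \<Rightarrow> 'v \<Rightarrow> 'v set" where
  "eta_path \<eta> A B = {A + t *\<^sub>R \<eta> B A | t. t \<in> {0..1}}"

text \<open>
  The spectral condition covers all operators occurring in the inequality: \<open>t = 0\<close> gives \<open>C\<close>, and
  \<open>C\<close> and \<open>D\<close> range over the same set.
\<close>

definition operator_preinvex ::
    "real set \<Rightarrow> (real \<Rightarrow> real) \<Rightarrow> (('h::chilbert_space \<Rightarrow>\<^sub>L 'h) \<Rightarrow> ('h \<Rightarrow>\<^sub>L 'h) \<Rightarrow> ('h \<Rightarrow>\<^sub>L 'h))
      \<Rightarrow> ('h \<Rightarrow>\<^sub>L 'h) set \<Rightarrow> bool" where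
  "operator_preinvex I f \<eta> S \<longleftrightarrow>
    is_interval I \<and> continuous_on I f \<and>
    (\<forall>C\<in>S. \<forall>D\<in>S. \<forall>t\<in>{0..1}.
       spectrum (C + t *\<^sub>R \<eta> D C) \<subseteq> complex_of_real ` I \<and>
       fun_op f (C + t *\<^sub>R \<eta> D C) \<le>\<^sub>o\<^sub>p (1 - t) *\<^sub>R fun_op f C + t *\<^sub>R fun_op f D)"

end

(*
  On the path s |-> A + s eta(B,A) condition C turns operator preinvexity into convexity of
  g(s) = <f(A + s eta(B,A)) x, x> for every x, and f >= 0 makes g nonnegative.  Integration by parts
  rewrites the trapezoid error of t |-> int_0^t g as 1/(b-a) int_a^b (t - (a+b)/2) g(t) dt, which is
  at most (b-a)/8 (g(a) + g(b)) because g lies below its chord.  The left-hand operator is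
  selfadjoint, so its norm is its numerical radius and the norm inequality follows.

  The functional calculus is obtained from polynomials: for a complex polynomial p and N = ||p(A)||
  the operator N^2 - p(A)* p(A) is not bounded below, so by the fundamental theorem of algebra some
  factor A - z of it is not, and there |p(z)| = N.  Thus p |-> p(A) is isometric on the spectrum and
  extends by the Weierstrass theorem.  Uniform approximation by polynomials on the compact union of
  the spectra along the path also yields the norm continuity of s |-> f(A + s eta(B,A)).
*)
theory Submission
  imports Defs "HOL-Computational_Algebra.Fundamental_Theorem_Algebra"
begin

section \<open>Inner products and bounded operators\<close>

text \<open>\<open>fun_op\<close> is a definite description over all functional calculi of an
  operator. It carries no information until existence and uniqueness are both proved, which is why a
  whole calculus is built. The working tool is a criterion: a point lies outside the spectrum of a
  selfadjoint operator exactly when the shifted operator is bounded below. Lower bounds multiply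
  along a factorization and survive small perturbations, so no resolvent series is used. A zero of
  the defect polynomial in the spectrum must be found even when that polynomial vanishes
  identically; hence the separate proof that the spectrum is nonempty. The factor 1/8 arises as
  follows: the integral of |t - m| over [a,b], with m the midpoint, is (b-a)^2/4; it is multiplied
  by the mean (g(a) + g(b))/2 of the chord and divided by b - a. The slope of the chord cancels by
  symmetry about m. Since g is nonnegative, |(t - m) g(t)| is |t - m| g(t), so the upper bound of g
  by its chord suffices.\<close>

lemma scaleC_of_real [simp]: "complex_of_real r *\<^sub>C (x::'a::complex_vector) = r *\<^sub>R x"
  by (simp add: scaleR_scaleC)

lemma scaleC_simps [simp]:
  fixes x :: "'a::complex_vector"
  shows "0 *\<^sub>C x = 0" "c *\<^sub>C (0::'a) = 0" "1 *\<^sub>C x = x"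
proof -
  show "0 *\<^sub>C x = 0" using scaleC_add_left[of 0 0 x] by simp
  show "c *\<^sub>C (0::'a) = 0" using scaleC_add_right[of c 0 "0::'a"] by simp
qed (rule scaleC_one)

lemma scaleC_minus_right: "c *\<^sub>C (- x) = - (c *\<^sub>C (x::'a::complex_vector))"
  using scaleC_add_right[of c x "- x"] by (simp add: eq_neg_iff_add_eq_0 add.commute)

lemma scaleC_diff_right: "c *\<^sub>C (x - y) = c *\<^sub>C x - c *\<^sub>C (y::'a::complex_vector)"
  using scaleC_add_right[of c x "- y"] by (simp add: scaleC_minus_right)

lemma scaleC_minus_left: "(- c) *\<^sub>C x = - (c *\<^sub>C (x::'a::complex_vector))"
  using scaleC_add_left[of c "- c" x] by (simp add: eq_neg_iff_add_eq_0 add.commute)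

lemma scaleC_diff_left: "(a - b) *\<^sub>C x = a *\<^sub>C x - b *\<^sub>C (x::'a::complex_vector)"
  using scaleC_add_left[of a "- b" x] by (simp add: scaleC_minus_left)

lemma scaleC_scaleR_commute: "c *\<^sub>C (r *\<^sub>R x) = r *\<^sub>R (c *\<^sub>C (x::'a::complex_vector))"
  by (simp add: scaleR_scaleC scaleC_scaleC mult.commute del: scaleC_of_real)

lemma cinner_add_right: "cinner x (y + z) = cinner x y + cinner x (z::'a::complex_inner)"
  using cinner_commute[of x "y + z"] cinner_commute[of y x] cinner_commute[of z x]
  by (simp add: cinner_add_left)

lemma cinner_scaleC_right: "cinner x (c *\<^sub>C y) = cnj c * cinner x (y::'a::complex_inner)"
  using cinner_commute[of x "c *\<^sub>C y"] cinner_commute[of y x]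
  by (simp add: cinner_scaleC_left)

lemma cinner_scaleR_left: "cinner (r *\<^sub>R x) y = complex_of_real r * cinner x (y::'a::complex_inner)"
  by (simp add: scaleR_scaleC cinner_scaleC_left del: scaleC_of_real)

lemma cinner_scaleR_right: "cinner x (r *\<^sub>R y) = complex_of_real r * cinner x (y::'a::complex_inner)"
  by (simp add: scaleR_scaleC cinner_scaleC_right del: scaleC_of_real)

lemma cinner_minus_left: "cinner (- x) y = - cinner x (y::'a::complex_inner)"
  using cinner_scaleR_left[of "-1" x y] by simp

lemma cinner_minus_right: "cinner x (- y) = - cinner x (y::'a::complex_inner)"
  using cinner_scaleR_right[of x "-1" y] by simp

lemma cinner_diff_left: "cinner (x - y) z = cinner x z - cinner y (z::'a::complex_inner)"
  using cinner_add_left[of x "- y" z] by (simp add: cinner_minus_left)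

lemma cinner_diff_right: "cinner x (y - z) = cinner x y - cinner x (z::'a::complex_inner)"
  using cinner_add_right[of x y "- z"] by (simp add: cinner_minus_right)

lemma cinner_zero [simp]:
  "cinner 0 (x::'a::complex_inner) = 0" "cinner x (0::'a::complex_inner) = 0"
  using cinner_scaleR_left[of 0 0 x] cinner_scaleR_right[of x 0 0] by simp_all

lemma cinner_self: "cinner x x = complex_of_real ((norm (x::'a::complex_inner))\<^sup>2)"
proof (rule complex_eqI)
  show "Re (cinner x x) = Re (complex_of_real ((norm x)\<^sup>2))"
    using norm_eq_sqrt_cinner[of x] cinner_ge_zero[of x] by simp
  show "Im (cinner x x) = Im (complex_of_real ((norm x)\<^sup>2))"
    using arg_cong[OF cinner_commute[of x x], of Im] by simp
qed

lemma norm_eq_sqrt_Re: "(norm (x::'a::complex_inner))\<^sup>2 = Re (cinner x x)"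
  by (simp add: cinner_self)

lemma norm_add_sq: "(norm (x + y))\<^sup>2 = (norm x)\<^sup>2 + 2 * Re (cinner x y) + (norm (y::'a::complex_inner))\<^sup>2"
  using arg_cong[OF cinner_commute[of y x], of Re]
  by (simp add: norm_eq_sqrt_Re cinner_add_left cinner_add_right)

lemma norm_diff_sq: "(norm (x - y))\<^sup>2 = (norm x)\<^sup>2 - 2 * Re (cinner x y) + (norm (y::'a::complex_inner))\<^sup>2"
  using norm_add_sq[of x "- y"] by (simp add: cinner_minus_right)

lemma norm_scaleC: "norm (c *\<^sub>C x) = cmod c * norm (x::'a::complex_inner)"
proof -
  have "complex_of_real ((norm (c *\<^sub>C x))\<^sup>2) = (c * cnj c) * complex_of_real ((norm x)\<^sup>2)"
    unfolding cinner_self[symmetric] by (simp add: cinner_scaleC_left cinner_scaleC_right)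
  also have "\<dots> = complex_of_real ((cmod c * norm x)\<^sup>2)"
    by (simp add: complex_norm_square[symmetric] power_mult_distrib del: of_real_power)
  finally have "(norm (c *\<^sub>C x))\<^sup>2 = (cmod c * norm x)\<^sup>2"
    by (simp only: of_real_eq_iff)
  then show ?thesis by (simp add: power2_eq_iff_nonneg)
qed

text \<open>Cauchy-Schwarz. Expanding the square of
  \<open>norm v *\<^sub>R u - norm u *\<^sub>R v\<close> gives the real part; multiplying
  \<open>x\<close> by a unimodular \<open>c\<close> then makes the inner product real and
  nonnegative.\<close>

lemma cmod_cinner_le: "cmod (cinner x y) \<le> norm x * norm (y::'a::complex_inner)"
proof -
  have re: "Re (cinner u v) \<le> norm u * norm v" for u v :: 'a
  proof (cases "u = 0 \<or> v = 0")
    case False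
    have "0 \<le> (norm (norm v *\<^sub>R u - norm u *\<^sub>R v))\<^sup>2" by simp
    also have "\<dots> = 2 * (norm u * norm v) * (norm u * norm v - Re (cinner u v))"
      unfolding norm_diff_sq
      by (simp add: cinner_scaleR_left cinner_scaleR_right power_mult_distrib power2_eq_square
          algebra_simps)
    finally show ?thesis using False
      by (simp add: zero_le_mult_iff mult_le_0_iff)
  qed auto
  show ?thesis
  proof (cases "cinner x y = 0")
    case False
    define c where "c = cnj (cinner x y) / cmod (cinner x y)"
    have "c * cinner x y = cmod (cinner x y)"
      using False by (simp add: c_def complex_norm_square[symmetric] mult.commute power2_eq_square)
    then have "cmod (cinner x y) = Re (cinner (c *\<^sub>C x) y)"
      by (simp add: cinner_scaleC_left)
    also have "\<dots> \<le> norm (c *\<^sub>C x) * norm y" by (rule re)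
    also have "\<dots> = norm x * norm y" using False by (simp add: norm_scaleC c_def norm_divide)
    finally show ?thesis .
  qed auto
qed

lemma bounded_bilinear_cinner: "bounded_bilinear (cinner :: 'a::complex_inner \<Rightarrow> 'a \<Rightarrow> complex)"
  by (rule bounded_bilinear.intro)
    (auto simp: cinner_add_left cinner_add_right cinner_scaleR_left cinner_scaleR_right
      scaleR_conv_of_real intro!: exI[of _ 1] cmod_cinner_le)

section \<open>Complex scalars, complex-linear operators and selfadjoint operators\<close>

lemma bounded_linear_scaleC: "bounded_linear (\<lambda>x::'a::complex_inner. c *\<^sub>C x)"
  by (rule bounded_linear_intro[of _ "cmod c"])
    (simp_all add: scaleC_add_right scaleC_scaleR_commute norm_scaleC mult.commute)

text \<open>The operator type is used as a real vector space; complex multiples of operators are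
  written as compositions with \<open>scalar_op c\<close>.\<close>

definition scalar_op :: "complex \<Rightarrow> ('h::chilbert_space \<Rightarrow>\<^sub>L 'h)" where
  "scalar_op c = Blinfun (\<lambda>x. c *\<^sub>C x)"

lemma scalar_op_apply [simp]: "blinfun_apply (scalar_op c) x = c *\<^sub>C x"
  by (simp add: scalar_op_def bounded_linear_Blinfun_apply bounded_linear_scaleC)

lemma BH_scaleC: "T \<in> BH \<Longrightarrow> blinfun_apply T (c *\<^sub>C x) = c *\<^sub>C blinfun_apply T x"
  by (simp add: BH_def)

lemma BH_intros:
  shows BH_zero: "0 \<in> BH" and BH_id: "id_blinfun \<in> BH" and BH_scalar_op: "scalar_op c \<in> BH"
    and BH_add: "T \<in> BH \<Longrightarrow> U \<in> BH \<Longrightarrow> T + U \<in> BH"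
    and BH_diff: "T \<in> BH \<Longrightarrow> U \<in> BH \<Longrightarrow> T - U \<in> BH"
    and BH_compose: "T \<in> BH \<Longrightarrow> U \<in> BH \<Longrightarrow> T o\<^sub>L U \<in> BH"
    and BH_scaleR: "T \<in> BH \<Longrightarrow> r *\<^sub>R T \<in> BH"
  by (simp_all add: BH_def blinfun.add_left blinfun.diff_left blinfun.scaleR_left
      scaleC_add_right scaleC_diff_right scaleC_scaleC scaleC_scaleR_commute mult.commute)

lemma BH_sa_BH: "T \<in> BH_sa \<Longrightarrow> T \<in> BH"
  and BH_sa_cinner: "T \<in> BH_sa \<Longrightarrow> cinner (blinfun_apply T x) y = cinner x (blinfun_apply T y)"
  by (auto simp: BH_sa_def)

lemma BH_sa_add: "T \<in> BH_sa \<Longrightarrow> U \<in> BH_sa \<Longrightarrow> T + U \<in> BH_sa"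
  and BH_sa_diff: "T \<in> BH_sa \<Longrightarrow> U \<in> BH_sa \<Longrightarrow> T - U \<in> BH_sa"
  and BH_sa_scaleR: "T \<in> BH_sa \<Longrightarrow> r *\<^sub>R T \<in> BH_sa"
  by (simp_all add: BH_sa_def BH_intros blinfun.add_left blinfun.diff_left blinfun.scaleR_left
      cinner_add_left cinner_add_right cinner_diff_left cinner_diff_right
      cinner_scaleR_left cinner_scaleR_right)

lemma cinner_BH_sa_real: "T \<in> BH_sa \<Longrightarrow> cinner (blinfun_apply T x) x = complex_of_real (Re (cinner (blinfun_apply T x) x))"
  using cinner_commute[of x "blinfun_apply T x"]
  by (metis BH_sa_cinner Reals_cnj_iff of_real_Re)

text \<open>By polarization, the numerical radius of a selfadjoint operator bounds its norm.\<close>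

lemma norm_BH_sa_le:
  assumes T: "T \<in> BH_sa" and M: "\<And>x. norm x = 1 \<Longrightarrow> \<bar>Re (cinner (blinfun_apply T x) x)\<bar> \<le> M" and "0 \<le> M"
  shows "norm (T :: 'h::chilbert_space \<Rightarrow>\<^sub>L 'h) \<le> M"
proof (rule norm_blinfun_bound[OF \<open>0 \<le> M\<close>])
  fix x :: 'h
  have M': "\<bar>Re (cinner (T z) z)\<bar> \<le> M * (norm z)\<^sup>2" for z
  proof (cases "z = 0")
    case False
    define u where "u = (1 / norm z) *\<^sub>R z"
    have zu: "norm z *\<^sub>R u = z" "norm u = 1" using False by (simp_all add: u_def)
    have "Re (cinner (T (norm z *\<^sub>R u)) (norm z *\<^sub>R u)) = (norm z)\<^sup>2 * Re (cinner (T u) u)"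
      by (simp add: blinfun.scaleR_right cinner_scaleR_left cinner_scaleR_right power2_eq_square)
    then have "Re (cinner (T z) z) = (norm z)\<^sup>2 * Re (cinner (T u) u)"
      by (simp only: zu(1))
    then show ?thesis using M[OF \<open>norm u = 1\<close>]
      by (simp add: abs_mult mult.commute[of M] mult_left_mono)
  qed simp
  show "norm (T x) \<le> M * norm x"
  proof (cases "x = 0 \<or> T x = 0")
    case False
    \<comment> \<open>With \<open>T x\<close> rescaled to the norm of \<open>x\<close>, the inner
      product of \<open>T x\<close> and \<open>y\<close> is \<open>norm x * norm (T x)\<close>, and
      the parallelogram law bounds it by \<open>M\<close> times the square of
      \<open>norm x\<close>.\<close>
    define y where "y = (norm x / norm (T x)) *\<^sub>R T x"
    have ny: "norm y = norm x" using False by (simp add: y_def)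
    have sym: "Re (cinner (T y) x) = Re (cinner (T x) y)"
      using cinner_commute[of "T y" x] BH_sa_cinner[OF T, of x y] by simp
    have "4 * Re (cinner (T x) y) = Re (cinner (T (x + y)) (x + y)) - Re (cinner (T (x - y)) (x - y))"
      using sym by (simp add: blinfun.add_right blinfun.diff_right cinner_add_left cinner_add_right
          cinner_diff_left cinner_diff_right)
    also have "\<dots> \<le> M * (norm (x + y))\<^sup>2 + M * (norm (x - y))\<^sup>2"
      using M'[of "x + y"] M'[of "x - y"] by linarith
    also have "\<dots> = 4 * (M * (norm x)\<^sup>2)"
      by (simp add: norm_add_sq norm_diff_sq ny algebra_simps)
    finally have *: "Re (cinner (T x) y) \<le> M * (norm x)\<^sup>2" by simp
    have "Re (cinner (T x) y) = norm x * norm (T x)"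
      using False by (simp add: y_def cinner_scaleR_right cinner_self power2_eq_square)
    with * False show ?thesis by (simp add: power2_eq_square)
  qed (use \<open>0 \<le> M\<close> in auto)
qed


section \<open>Invertibility and the spectrum of a selfadjoint operator\<close>

text \<open>The solution of \<open>Q x = y\<close> is the fixed point of the contraction \<open>x \<mapsto> x - k (Q x - y)\<close>.\<close>

lemma coercive_bij:
  fixes Q :: "'h::chilbert_space \<Rightarrow>\<^sub>L 'h"
  assumes c: "0 < c" and Q: "\<And>x. c * (norm x)\<^sup>2 \<le> Re (cinner (blinfun_apply Q x) x)"
  shows "\<exists>!x. blinfun_apply Q x = y"
proof -
  \<comment> \<open>Adding \<open>c\<close> makes \<open>0 < M\<close> and \<open>c \<le> M\<close>
    immediate. The squared contraction factor is at most 1 - 2kc + k^2 M^2; \<open>k\<close> is the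
    minimizer of this quadratic, and its minimum is the square of \<open>q\<close>.\<close>
  define M where "M = norm Q + c"
  define k where "k = c / M\<^sup>2"
  define q where "q = sqrt (1 - c\<^sup>2 / M\<^sup>2)"
  have M: "0 < M" "c \<le> M" "norm Q \<le> M" using c by (auto simp: M_def add_nonneg_pos)
  have k: "0 < k" using M c by (simp add: k_def)
  have "c\<^sup>2 / M\<^sup>2 \<le> 1" "0 < c\<^sup>2 / M\<^sup>2" using M c by (auto simp: power_mono divide_le_eq)
  then have q: "0 \<le> q" "q < 1" "q\<^sup>2 = 1 - c\<^sup>2 / M\<^sup>2" by (auto simp: q_def real_sqrt_lt_1_iff)
  have contr: "norm (x - k *\<^sub>R Q x) \<le> q * norm x" for x
  proof -
    have "norm (Q x) \<le> M * norm x"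
      using norm_blinfun[of Q x] M(3) by (meson mult_right_mono norm_ge_zero order_trans)
    then have "(norm (Q x))\<^sup>2 \<le> M\<^sup>2 * (norm x)\<^sup>2"
      by (metis norm_ge_zero power_mono power_mult_distrib)
    then have "k\<^sup>2 * (norm (Q x))\<^sup>2 \<le> k\<^sup>2 * (M\<^sup>2 * (norm x)\<^sup>2)" by (simp add: mult_left_mono)
    moreover have "k * (c * (norm x)\<^sup>2) \<le> k * Re (cinner (Q x) x)" using Q[of x] k by simp
    moreover have "Re (cinner x (Q x)) = Re (cinner (Q x) x)"
      using cinner_commute[of x "Q x"] by simp
    ultimately have "(norm (x - k *\<^sub>R Q x))\<^sup>2 \<le> (norm x)\<^sup>2 - 2 * (k * (c * (norm x)\<^sup>2)) + k\<^sup>2 * (M\<^sup>2 * (norm x)\<^sup>2)"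
      by (simp add: norm_diff_sq cinner_scaleR_right power_mult_distrib)
    also have "\<dots> = (1 - c\<^sup>2 / M\<^sup>2) * (norm x)\<^sup>2"
      using M by (simp add: k_def field_simps power2_eq_square)
    also have "\<dots> = (q * norm x)\<^sup>2" by (simp add: q power_mult_distrib)
    finally show ?thesis using q(1) by (simp add: power2_le_iff_abs_le)
  qed
  define g where "g x = x - k *\<^sub>R (Q x - y)" for x
  have "\<exists>!x. g x = x"
  proof (rule banach_fix_type[OF q(1,2)], intro allI)
    fix u v
    have "g u - g v = (u - v) - k *\<^sub>R Q (u - v)"
      by (simp add: g_def blinfun.diff_right algebra_simps)
    then show "dist (g u) (g v) \<le> q * dist u v"
      using contr[of "u - v"] by (simp add: dist_norm)
  qed
  moreover have "g x = x \<longleftrightarrow> Q x = y" for x using k by (auto simp: g_def)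
  ultimately show ?thesis by simp
qed

text \<open>The operator \<open>N = A - z\<close> commutes with its adjoint
  \<open>N' = A - cnj z\<close>. A lower bound for \<open>N\<close> makes \<open>N' N\<close>
  coercive, hence bijective, and \<open>N'\<close> applied after the inverse of \<open>N' N\<close>
  is a right inverse of \<open>N\<close>.\<close>

lemma not_spectrum_iff_bounded_below:
  fixes A :: "'h::chilbert_space \<Rightarrow>\<^sub>L 'h"
  assumes A: "A \<in> BH_sa"
  shows "z \<notin> spectrum A \<longleftrightarrow> (\<exists>c>0. \<forall>x. c * norm x \<le> norm (blinfun_apply A x - z *\<^sub>C x))"
proof
  assume "z \<notin> spectrum A"
  then obtain R where R: "R \<in> BH" "\<And>x. R (A x - z *\<^sub>C x) = x"
    unfolding spectrum_def by blast
  have "1 / (norm R + 1) * norm x \<le> norm (A x - z *\<^sub>C x)" for x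
  proof -
    have "norm x \<le> norm R * norm (A x - z *\<^sub>C x)"
      using norm_blinfun[of R "A x - z *\<^sub>C x"] R(2)[of x] by simp
    also have "\<dots> \<le> (norm R + 1) * norm (A x - z *\<^sub>C x)" by (simp add: mult_right_mono)
    finally show ?thesis
      using norm_ge_zero[of R] by (simp add: divide_le_eq mult.commute add_nonneg_pos)
  qed
  then show "\<exists>c>0. \<forall>x. c * norm x \<le> norm (A x - z *\<^sub>C x)"
    by (intro exI[of _ "1 / (norm R + 1)"]) (auto simp: add_nonneg_pos)
next
  assume "\<exists>c>0. \<forall>x. c * norm x \<le> norm (A x - z *\<^sub>C x)"
  then obtain c where c: "c > 0" "\<And>x. c * norm x \<le> norm (A x - z *\<^sub>C x)" by auto
  define N where "N = A - scalar_op z"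
  define N' where "N' = A - scalar_op (cnj z)"
  have N: "N x = A x - z *\<^sub>C x" for x by (simp add: N_def blinfun.diff_left)
  have BHs: "N \<in> BH" "N' \<in> BH" using BH_sa_BH[OF A] by (auto simp: N_def N'_def BH_intros)
  have adj: "cinner (N' x) y = cinner x (N y)" for x y
    by (simp add: N_def N'_def blinfun.diff_left cinner_diff_left cinner_diff_right
        cinner_scaleC_left cinner_scaleC_right BH_sa_cinner[OF A])
  have comm: "N (N' x) = N' (N x)" for x
    by (simp add: N_def N'_def blinfun.diff_left blinfun.diff_right BH_scaleC[OF BH_sa_BH[OF A]]
        scaleC_diff_right scaleC_scaleC mult.commute)
  define Q where "Q = N' o\<^sub>L N"
  have Q: "c\<^sup>2 * (norm x)\<^sup>2 \<le> Re (cinner (Q x) x)" for x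
  proof -
    have "(c * norm x)\<^sup>2 \<le> (norm (N x))\<^sup>2" using c by (intro power_mono) (auto simp: N)
    then show ?thesis by (simp add: Q_def adj norm_eq_sqrt_Re[of "N x"] power_mult_distrib)
  qed
  have bij: "\<exists>!x. Q x = y" for y by (rule coercive_bij[OF _ Q]) (use c in simp)
  define X where "X y = N' (THE x. Q x = y)" for y
  have QX: "Q (THE x. Q x = y) = y" for y by (rule theI'[OF bij])
  have inv1: "N (X y) = y" for y using QX[of y] by (simp add: X_def comm Q_def)
  \<comment> \<open>The lower bound makes \<open>N\<close> injective. Linearity, complex linearity
    and the left inverse property of \<open>X\<close> all follow by applying \<open>N\<close> to
    both sides.\<close>
  have inj: "N u = N v \<Longrightarrow> u = v" for u v
    using c(2)[of "u - v", folded N] c(1) by (simp add: blinfun.diff_right mult_le_0_iff)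
  have inv2: "X (N x) = x" for x by (rule inj) (simp add: inv1)
  have "bounded_linear X"
  proof (rule bounded_linear_intro[of _ "1 / c"])
    show "X (x + y) = X x + X y" for x y by (rule inj) (simp add: inv1 blinfun.add_right)
    show "X (r *\<^sub>R x) = r *\<^sub>R X x" for r x by (rule inj) (simp add: inv1 blinfun.scaleR_right)
    show "norm (X x) \<le> norm x * (1 / c)" for x
      using c(2)[of "X x"] c(1) by (simp add: N[symmetric] inv1 field_simps)
  qed
  then have Xa: "Blinfun X x = X x" for x by (simp add: bounded_linear_Blinfun_apply)
  have "X (d *\<^sub>C x) = d *\<^sub>C X x" for d x
    by (rule inj) (simp add: inv1 BH_scaleC[OF BHs(1)])
  then have "Blinfun X \<in> BH" by (simp add: BH_def Xa)
  then show "z \<notin> spectrum A"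
    unfolding spectrum_def by (auto intro!: bexI[of _ "Blinfun X"] simp: Xa N[symmetric] inv1 inv2)
qed

text \<open>The imaginary part of the inner product of \<open>A x - z *\<^sub>C x\<close> with
  \<open>x\<close> is - Im z times the squared norm of \<open>x\<close>, so Cauchy-Schwarz gives the
  lower bound \<open>\<bar>Im z\<bar>\<close> off the real axis.\<close>

lemma spectrum_real:
  fixes A :: "'h::chilbert_space \<Rightarrow>\<^sub>L 'h"
  assumes A: "A \<in> BH_sa" and z: "z \<in> spectrum A"
  shows "z = complex_of_real (Re z)"
proof (rule ccontr)
  assume "z \<noteq> complex_of_real (Re z)"
  then have im: "Im z \<noteq> 0" by (auto simp: complex_eq_iff)
  have "\<bar>Im z\<bar> * norm x \<le> norm (A x - z *\<^sub>C x)" for x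
  proof (cases "x = 0")
    case False
    have "Im (cinner (A x - z *\<^sub>C x) x) = - Im z * (norm x)\<^sup>2"
      using arg_cong[OF cinner_BH_sa_real[OF A, of x], of Im]
      by (simp add: cinner_diff_left cinner_scaleC_left cinner_self)
    then have "\<bar>Im z\<bar> * (norm x)\<^sup>2 \<le> cmod (cinner (A x - z *\<^sub>C x) x)"
      using abs_Im_le_cmod[of "cinner (A x - z *\<^sub>C x) x"] by (simp add: abs_mult)
    also have "\<dots> \<le> norm (A x - z *\<^sub>C x) * norm x" by (rule cmod_cinner_le)
    finally show ?thesis using False by (simp add: power2_eq_square)
  qed simp
  then show False using not_spectrum_iff_bounded_below[OF A, of z] z im
    by (metis zero_less_abs_iff)
qed

lemma spectrum_cmod_le:
  fixes A :: "'h::chilbert_space \<Rightarrow>\<^sub>L 'h"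
  assumes A: "A \<in> BH_sa" and z: "z \<in> spectrum A"
  shows "cmod z \<le> norm A"
proof (rule ccontr)
  assume "\<not> cmod z \<le> norm A"
  moreover have "(cmod z - norm A) * norm x \<le> norm (A x - z *\<^sub>C x)" for x
    using norm_triangle_ineq2[of "z *\<^sub>C x" "A x"] norm_blinfun[of A x]
    by (simp add: norm_scaleC norm_minus_commute algebra_simps)
  ultimately show False using not_spectrum_iff_bounded_below[OF A, of z] z
    by (metis diff_gt_0_iff_gt not_le)
qed

text \<open>A parameter and a point of its spectrum are extracted together from the compact set
  \<open>K \<times> cball 0 M\<close>. The limit point is in the spectrum of the limit operator,
  because being bounded below is an open condition. A one-point \<open>K\<close> gives compactness
  of a single spectrum.\<close>

lemma compact_UN_spectrum:
  fixes F :: "'a::metric_space \<Rightarrow> ('h::chilbert_space \<Rightarrow>\<^sub>L 'h)"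
  assumes F: "continuous_on K F" "\<And>s. s \<in> K \<Longrightarrow> F s \<in> BH_sa" and K: "compact K"
  shows "compact (\<Union>s\<in>K. spectrum (F s))"
proof -
  have "bounded (F ` K)" using compact_imp_bounded[OF compact_continuous_image[OF F(1) K]] .
  then obtain M where M: "\<And>s. s \<in> K \<Longrightarrow> norm (F s) \<le> M"
    unfolding bounded_iff by blast
  have "\<exists>l\<in>(\<Union>s\<in>K. spectrum (F s)). \<exists>r. strict_mono r \<and> (z \<circ> r) \<longlonglongrightarrow> l"
    if z: "\<forall>n. z n \<in> (\<Union>s\<in>K. spectrum (F s))" for z :: "nat \<Rightarrow> complex"
  proof -
    have "\<forall>n. \<exists>t. t \<in> K \<and> z n \<in> spectrum (F t)" using z by blast
    then obtain s where s: "\<And>n. s n \<in> K" "\<And>n. z n \<in> spectrum (F (s n))" by metis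
    have "z n \<in> cball 0 M" for n
      using spectrum_cmod_le[OF F(2)[OF s(1)] s(2)] M[OF s(1)[of n]] by (force intro: order_trans)
    then have "(s n, z n) \<in> K \<times> cball 0 M" for n using s(1) by simp
    moreover have "seq_compact (K \<times> cball (0::complex) M)"
      using compact_Times[OF K compact_cball] by (simp add: compact_eq_seq_compact_metric)
    ultimately obtain l r where l: "l \<in> K \<times> cball 0 M" "strict_mono r" "((\<lambda>n. (s n, z n)) \<circ> r) \<longlonglongrightarrow> l"
      unfolding seq_compact_def by (elim allE[of _ "\<lambda>n. (s n, z n)"]) blast
    define w where "w = snd l"
    define t where "t = fst l"
    have t: "t \<in> K" "(\<lambda>n. s (r n)) \<longlonglongrightarrow> t" and w: "(\<lambda>n. z (r n)) \<longlonglongrightarrow> w"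
      using l tendsto_fst[OF l(3)] tendsto_snd[OF l(3)] by (auto simp: t_def w_def o_def)
    have Ft: "(\<lambda>n. F (s (r n))) \<longlonglongrightarrow> F t"
      using F(1) t s(1) by (auto simp: continuous_on_sequentially o_def)
    have "w \<in> spectrum (F t)"
    proof (rule ccontr)
      assume "w \<notin> spectrum (F t)"
      then obtain c where c: "c > 0" "\<And>x. c * norm x \<le> norm (F t x - w *\<^sub>C x)"
        using not_spectrum_iff_bounded_below[OF F(2)[OF t(1)]] by auto
      have "(\<lambda>n. norm (F (s (r n)) - F t) + cmod (z (r n) - w)) \<longlonglongrightarrow> 0"
        using Ft w by (auto intro!: tendsto_add_zero tendsto_norm_zero simp: LIM_zero_iff)
      then have "\<forall>\<^sub>F n in sequentially. norm (F (s (r n)) - F t) + cmod (z (r n) - w) < c / 2"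
        using c(1) by (auto dest: order_tendstoD(2)[where a="c/2"])
      then obtain n where n: "norm (F (s (r n)) - F t) + cmod (z (r n) - w) < c / 2"
        by (auto simp: eventually_sequentially)
      \<comment> \<open>Replacing the limit pair by its \<open>n\<close>-th approximation costs less
        than half of the lower bound \<open>c\<close>, so a point of the spectrum would be outside
        it.\<close>
      have "c / 2 * norm x \<le> norm (F (s (r n)) x - z (r n) *\<^sub>C x)" for x
      proof -
        have "F t x - w *\<^sub>C x = (F (s (r n)) x - z (r n) *\<^sub>C x) - ((F (s (r n)) - F t) x - (z (r n) - w) *\<^sub>C x)"
          by (simp add: blinfun.diff_left scaleC_diff_left)
        then have "norm (F t x - w *\<^sub>C x) \<le> norm (F (s (r n)) x - z (r n) *\<^sub>C x)
            + norm ((F (s (r n)) - F t) x - (z (r n) - w) *\<^sub>C x)"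
          by (metis norm_triangle_ineq4)
        also have "norm ((F (s (r n)) - F t) x - (z (r n) - w) *\<^sub>C x)
            \<le> norm (F (s (r n)) - F t) * norm x + cmod (z (r n) - w) * norm x"
          by (rule order_trans[OF norm_triangle_ineq4])
            (intro add_mono norm_blinfun, simp add: norm_scaleC)
        also have "\<dots> = (norm (F (s (r n)) - F t) + cmod (z (r n) - w)) * norm x"
          by (simp add: algebra_simps)
        also have "\<dots> \<le> c / 2 * norm x" using n by (intro mult_right_mono) auto
        finally have "norm (F t x - w *\<^sub>C x) \<le> norm (F (s (r n)) x - z (r n) *\<^sub>C x) + c / 2 * norm x"
          by simp
        then show ?thesis using c(2)[of x] by (simp add: field_simps)
      qed
      then show False
        using s(2)[of "r n"] not_spectrum_iff_bounded_below[OF F(2)[OF s(1)[of "r n"]], of "z (r n)"] c(1)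
        by (metis half_gt_zero)
    qed
    then show ?thesis using t(1) l(2) w by (auto simp: o_def)
  qed
  then show ?thesis unfolding compact_eq_seq_compact_metric seq_compact_def by blast
qed


section \<open>Polynomials of a selfadjoint operator\<close>

definition poly_op :: "('h::chilbert_space \<Rightarrow>\<^sub>L 'h) \<Rightarrow> complex poly \<Rightarrow> ('h \<Rightarrow>\<^sub>L 'h)" where
  "poly_op A p = fold_coeffs (\<lambda>c T. scalar_op c + (A o\<^sub>L T)) p 0"

lemma poly_op_0 [simp]: "poly_op A 0 = 0"
  by (simp add: poly_op_def)

lemma scalar_op_0: "scalar_op 0 = 0"
  by (rule blinfun_eqI) simp

lemma poly_op_pCons [simp]: "poly_op A (pCons c p) = scalar_op c + (A o\<^sub>L poly_op A p)"
proof (cases "p = 0 \<and> c = 0")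
  case True
  then show ?thesis by (simp add: scalar_op_0)
next
  case False
  then show ?thesis by (cases "p = 0") (auto simp: poly_op_def)
qed

lemma poly_op_const [simp]: "poly_op A [:c:] = scalar_op c"
  and poly_op_X [simp]: "poly_op A [:0, 1:] = A"
  by (rule blinfun_eqI, simp add: blinfun.add_left)+

lemma poly_op_BH: "A \<in> BH \<Longrightarrow> poly_op A p \<in> BH"
  by (induction p) (simp_all add: BH_intros)

lemma poly_op_add: "poly_op A (p + q) = poly_op A p + poly_op A q"
proof (induction p q rule: poly_induct2)
  case (pCons a p b q)
  then show ?case
    by (intro blinfun_eqI)
      (simp add: blinfun.add_left blinfun.add_right scaleC_add_left)
qed simp

lemma poly_op_smult: "A \<in> BH \<Longrightarrow> poly_op A (smult c p) = scalar_op c o\<^sub>L poly_op A p"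
proof (induction p)
  case 0
  show ?case by (rule blinfun_eqI) simp
next
  case (pCons a p)
  then show ?case
    by (intro blinfun_eqI)
      (simp add: blinfun.add_left scaleC_add_right scaleC_scaleC BH_scaleC)
qed

lemma poly_op_diff: "A \<in> BH \<Longrightarrow> poly_op A (p - q) = poly_op A p - poly_op A q"
  using poly_op_add[of A "p - q" q] by simp

lemma poly_op_mult: "A \<in> BH \<Longrightarrow> poly_op A (p * q) = poly_op A p o\<^sub>L poly_op A q"
proof (induction p)
  case 0
  show ?case by (rule blinfun_eqI) simp
next
  case (pCons a p)
  then show ?case
    by (intro blinfun_eqI)
      (simp add: poly_op_add poly_op_smult scalar_op_0 blinfun.add_left blinfun.add_right)
qed

text \<open>Moving \<open>A\<close> across the inner product leaves it to the right of the remaining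
  polynomial, whereas the Horner form has it on the left; the induction step therefore needs that
  \<open>A\<close> commutes with its polynomials.\<close>

lemma poly_op_cinner:
  assumes A: "A \<in> BH_sa"
  shows "cinner (blinfun_apply (poly_op A p) x) y = cinner x (blinfun_apply (poly_op A (map_poly cnj p)) y)"
proof (induction p arbitrary: x y)
  case (pCons a p)
  have "A (poly_op A q v) = poly_op A q (A v)" for q v
    using poly_op_mult[OF BH_sa_BH[OF A], of q "[:0, 1:]"]
    unfolding mult.commute[of q] poly_op_mult[OF BH_sa_BH[OF A], of "[:0, 1:]" q] poly_op_X
    by (metis blinfun_apply_blinfun_compose)
  then show ?case
    using pCons.IH
    by (simp add: map_poly_pCons blinfun.add_left cinner_add_left cinner_add_right
        cinner_scaleC_left cinner_scaleC_right BH_sa_cinner[OF A])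
qed simp

text \<open>If \<open>cmod (poly p z)\<close> exceeded the norm of p(A) by \<open>d\<close>, then
  p(A) - p(z) would be bounded below by \<open>d\<close>. It factors as q(A)(A - z), so A - z would
  be bounded below too, contrary to \<open>z\<close> being in the spectrum.\<close>

lemma poly_spectrum_le:
  fixes A :: "'h::chilbert_space \<Rightarrow>\<^sub>L 'h"
  assumes A: "A \<in> BH_sa" and z: "z \<in> spectrum A"
  shows "cmod (poly p z) \<le> norm (poly_op A p)"
proof (rule ccontr)
  assume neg: "\<not> ?thesis"
  define d where "d = cmod (poly p z) - norm (poly_op A p)"
  have d: "0 < d" using neg by (simp add: d_def)
  have "[:- z, 1:] dvd p - [:poly p z:]" by (simp add: poly_eq_0_iff_dvd[symmetric])
  then obtain q where q: "p - [:poly p z:] = q * [:- z, 1:]" by (auto elim!: dvdE simp: mult.commute)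
  have eq: "poly_op A p x - poly p z *\<^sub>C x = poly_op A q (A x - z *\<^sub>C x)" for x
    using arg_cong[OF q, of "\<lambda>p. blinfun_apply (poly_op A p) x"]
    by (simp add: poly_op_diff poly_op_mult BH_sa_BH[OF A] blinfun.diff_left blinfun.add_left
        scaleC_minus_left del: mult_pCons_right)
  \<comment> \<open>The summand 1 keeps the denominator positive without a case distinction on
    \<open>poly_op A q = 0\<close>.\<close>
  have "d / (norm (poly_op A q) + 1) * norm x \<le> norm (A x - z *\<^sub>C x)" for x
  proof -
    have "d * norm x \<le> norm (poly p z *\<^sub>C x) - norm (poly_op A p x)"
      using norm_blinfun[of "poly_op A p" x] by (simp add: d_def norm_scaleC algebra_simps)
    also have "\<dots> \<le> norm (poly_op A p x - poly p z *\<^sub>C x)"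
      by (metis norm_minus_commute norm_triangle_ineq2)
    also have "\<dots> \<le> norm (poly_op A q) * norm (A x - z *\<^sub>C x)"
      unfolding eq by (rule norm_blinfun)
    also have "\<dots> \<le> (norm (poly_op A q) + 1) * norm (A x - z *\<^sub>C x)" by (simp add: mult_right_mono)
    finally show ?thesis
      using norm_ge_zero[of "poly_op A q"] by (simp add: divide_le_eq mult.commute add_nonneg_pos)
  qed
  moreover have "0 < d / (norm (poly_op A q) + 1)" using d by (simp add: add_nonneg_pos)
  ultimately have "z \<notin> spectrum A" using not_spectrum_iff_bounded_below[OF A] by blast
  then show False using z by simp
qed

text \<open>Each root of \<open>p\<close> lies outside the spectrum, so the corresponding linear
  factor is bounded below; splitting off one root at a time multiplies these bounds. The condition
  \<open>p \<noteq> 0\<close> matters when the spectrum is empty, where \<open>nz\<close> is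
  vacuous.\<close>

lemma poly_op_bounded_below:
  fixes A :: "'h::chilbert_space \<Rightarrow>\<^sub>L 'h"
  assumes A: "A \<in> BH_sa" and p: "p \<noteq> 0" and nz: "\<forall>z\<in>spectrum A. poly p z \<noteq> 0"
  shows "\<exists>c>0. \<forall>x. c * norm x \<le> norm (blinfun_apply (poly_op A p) x)"
  using p nz
proof (induction "degree p" arbitrary: p)
  case 0
  then obtain c where "p = [:c:]" "c \<noteq> 0" by (metis degree_eq_zeroE pCons_0_0)
  then show ?case by (intro exI[of _ "cmod c"]) (simp add: norm_scaleC blinfun.add_left)
next
  case (Suc n)
  then have "\<not> constant (poly p)" by (simp add: constant_degree)
  then obtain z where z: "poly p z = 0" using fundamental_theorem_of_algebra by blast
  then obtain q where q: "p = [:- z, 1:] * q" by (auto simp: poly_eq_0_iff_dvd elim!: dvdE)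
  have q0: "q \<noteq> 0" using q Suc.prems by auto
  then have "degree p = Suc (degree q)" unfolding q by (subst degree_mult_eq) auto
  moreover have "\<forall>w\<in>spectrum A. poly q w \<noteq> 0" using Suc.prems q by auto
  ultimately obtain c where c: "c > 0" "\<And>x. c * norm x \<le> norm (poly_op A q x)"
    using Suc.hyps(1)[of q] Suc.hyps(2) q0 by auto
  have "z \<notin> spectrum A" using z Suc.prems by auto
  then obtain d where d: "d > 0" "\<And>x. d * norm x \<le> norm (A x - z *\<^sub>C x)"
    using not_spectrum_iff_bounded_below[OF A] by auto
  have "d * c * norm x \<le> norm (poly_op A p x)" for x
  proof -
    have "poly_op A p x = A (poly_op A q x) - z *\<^sub>C poly_op A q x"
      unfolding q poly_op_mult[OF BH_sa_BH[OF A]] by (simp add: blinfun.add_left scaleC_minus_left)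
    then have "d * norm (poly_op A q x) \<le> norm (poly_op A p x)" using d by simp
    moreover have "d * (c * norm x) \<le> d * norm (poly_op A q x)" using c d by simp
    ultimately show ?thesis by (simp add: mult.assoc)
  qed
  then show ?case using c d by (intro exI[of _ "d * c"]) auto
qed

text \<open>With \<open>N = \<parallel>p(A)\<parallel>\<close> one has \<open>\<parallel>(N\<^sup>2 - p(A)\<^sup>* p(A)) x\<parallel>\<^sup>2 \<le> N\<^sup>2 (N\<^sup>2 \<parallel>x\<parallel>\<^sup>2 - \<parallel>p(A) x\<parallel>\<^sup>2)\<close>, which is
  small where \<open>\<parallel>p(A) x\<parallel>\<close> is close to \<open>N \<parallel>x\<parallel>\<close>.\<close>

lemma poly_op_defect_not_bounded_below:
  fixes A :: "'h::chilbert_space \<Rightarrow>\<^sub>L 'h"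
  assumes A: "A \<in> BH_sa" and N: "0 < norm (poly_op A p)"
  defines "r \<equiv> [:complex_of_real ((norm (poly_op A p))\<^sup>2):] - map_poly cnj p * p"
  shows "\<not> (\<exists>c>0. \<forall>x. c * norm x \<le> norm (blinfun_apply (poly_op A r) x))"
proof
  assume "\<exists>c>0. \<forall>x. c * norm x \<le> norm (poly_op A r x)"
  then obtain c where c: "c > 0" "\<And>x. c * norm x \<le> norm (poly_op A r x)" by auto
  define N where "N = norm (poly_op A p)"
  define P where "P = poly_op A p"
  define P' where "P' = poly_op A (map_poly cnj p)"
  have adj: "cinner (P x) y = cinner x (P' y)" for x y
    unfolding P_def P'_def by (rule poly_op_cinner[OF A])
  have adj': "cinner (P' y) x = cinner y (P x)" for x y
    using adj[of x y] cinner_commute[of "P' y" x] cinner_commute[of y "P x"] by simp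
  have r: "poly_op A r x = (N\<^sup>2) *\<^sub>R x - P' (P x)" for x
    by (simp add: r_def poly_op_diff poly_op_mult BH_sa_BH[OF A] blinfun.diff_left blinfun.add_left
        P_def P'_def N_def del: of_real_power)
  have bd: "norm (P' y) \<le> N * norm y" for y
  proof (cases "P' y = 0")
    case False
    have "(norm (P' y))\<^sup>2 \<le> norm (P (P' y)) * norm y"
      using cmod_cinner_le[of "P (P' y)" y] by (simp add: adj cinner_self del: of_real_power)
    also have "\<dots> \<le> (N * norm (P' y)) * norm y"
      using norm_blinfun[of P "P' y"] by (intro mult_right_mono) (auto simp: N_def P_def)
    finally show ?thesis using False by (simp add: power2_eq_square)
  qed (simp add: N_def)
  have N0: "0 < N" using N by (simp add: N_def)
  have key: "c\<^sup>2 * (norm x)\<^sup>2 \<le> N\<^sup>2 * (N\<^sup>2 * (norm x)\<^sup>2 - (norm (P x))\<^sup>2)" for x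
  proof -
    have "(c * norm x)\<^sup>2 \<le> (norm (poly_op A r x))\<^sup>2" using c by (intro power_mono) auto
    also have "\<dots> = N\<^sup>2 * N\<^sup>2 * (norm x)\<^sup>2 - 2 * (N\<^sup>2 * Re (cinner x (P' (P x)))) + (norm (P' (P x)))\<^sup>2"
      using N0 by (simp add: r norm_diff_sq cinner_scaleR_left power_mult_distrib flip: power2_eq_square)
    also have "Re (cinner x (P' (P x))) = (norm (P x))\<^sup>2"
      by (simp add: adj[symmetric] norm_eq_sqrt_Re)
    also have "(norm (P' (P x)))\<^sup>2 \<le> (N * norm (P x))\<^sup>2" by (intro power_mono bd) simp
    finally show ?thesis by (simp add: algebra_simps power_mult_distrib)
  qed
  \<comment> \<open>The estimate \<open>key\<close> bounds the squared norm of \<open>P x\<close> by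
    \<open>b\<close> times that of \<open>x\<close>. Both arguments of \<open>max\<close> are below
    the square of \<open>N\<close>, although \<open>N\<close> is the operator norm of
    \<open>P\<close>. The value 0 makes \<open>sqrt b\<close> meaningful without choosing a nonzero
    vector.\<close>
  define b where "b = max 0 (N\<^sup>2 - c\<^sup>2 / N\<^sup>2)"
  have "norm (P x) \<le> sqrt b * norm x" for x
  proof -
    have "(norm (P x))\<^sup>2 \<le> (N\<^sup>2 - c\<^sup>2 / N\<^sup>2) * (norm x)\<^sup>2"
      using key[of x] N0 by (simp add: field_simps)
    also have "\<dots> \<le> b * (norm x)\<^sup>2" by (intro mult_right_mono) (auto simp: b_def)
    also have "\<dots> = (sqrt b * norm x)\<^sup>2" by (simp add: power_mult_distrib b_def)
    finally show ?thesis by (simp add: power2_le_iff_abs_le b_def)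
  qed
  then have "norm P \<le> sqrt b" by (intro norm_blinfun_bound) (auto simp: b_def)
  then have "N \<le> sqrt b" by (simp add: N_def P_def)
  then have "N\<^sup>2 \<le> b" using N0 by (simp add: real_le_rsqrt b_def sqrt_ge_absD)
  moreover have "0 < c\<^sup>2 / N\<^sup>2" "0 < N\<^sup>2" using c N0 by auto
  ultimately show False unfolding b_def by linarith
qed

text \<open>For \<open>A = 0\<close> the point 0 is in the spectrum. Otherwise the defect polynomial
  of the identity polynomial is N^2 - X^2, nonzero by its leading coefficient; over an empty
  spectrum \<open>poly_op_bounded_below\<close> would apply to it, which
  \<open>poly_op_defect_not_bounded_below\<close> excludes.\<close>

lemma spectrum_nonempty:
  fixes A :: "'h::chilbert_space \<Rightarrow>\<^sub>L 'h"
  assumes A: "A \<in> BH_sa" and x: "x \<noteq> (0::'h)"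
  shows "spectrum A \<noteq> {}"
proof
  assume empty: "spectrum A = {}"
  have "A \<noteq> 0"
  proof
    assume "A = 0"
    then have "0 \<in> spectrum A" using x
      using not_spectrum_iff_bounded_below[OF A, of 0] by (force simp: mult_le_0_iff)
    then show False using empty by simp
  qed
  then have "0 < norm (poly_op A [:0, 1:])" by (simp del: poly_op_pCons)
  note nb = poly_op_defect_not_bounded_below[OF A this]
  let ?r = "[:complex_of_real ((norm (poly_op A [:0, 1:]))\<^sup>2):] - map_poly cnj [:0, 1:] * [:0, 1:]"
  have "coeff ?r 2 = -1" by (simp add: map_poly_pCons numeral_2_eq_2)
  then have "?r \<noteq> 0" by (metis coeff_0 zero_neq_neg_one)
  then show False using poly_op_bounded_below[OF A, of ?r] empty nb by blast
qed

text \<open>On the real spectrum the conjugate polynomial takes conjugate values, so the defect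
  polynomial \<open>r\<close> has the value N^2 - |p(z)|^2 there and the sought point is a zero of
  \<open>r\<close>. If \<open>r\<close> is the zero polynomial, any point of the nonempty spectrum
  will do.\<close>

lemma norm_poly_op_attained:
  fixes A :: "'h::chilbert_space \<Rightarrow>\<^sub>L 'h"
  assumes A: "A \<in> BH_sa" and N: "0 < norm (poly_op A p)"
  shows "\<exists>z\<in>spectrum A. cmod (poly p z) = norm (poly_op A p)"
proof -
  define r where "r = [:complex_of_real ((norm (poly_op A p))\<^sup>2):] - map_poly cnj p * p"
  have "\<exists>x::'h. x \<noteq> 0" using N by (metis blinfun.zero_right blinfun_eqI norm_zero zero_blinfun.rep_eq order_less_irrefl)
  then have "spectrum A \<noteq> {}" using spectrum_nonempty[OF A] by blast
  moreover have "\<not> (\<exists>c>0. \<forall>x. c * norm x \<le> norm (poly_op A r x))"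
    using poly_op_defect_not_bounded_below[OF A N] by (simp add: r_def)
  ultimately obtain z where z: "z \<in> spectrum A" "poly r z = 0"
    using poly_op_bounded_below[OF A, of r] by (metis all_not_in_conv poly_0)
  have "poly (map_poly cnj p) z = cnj (poly p z)"
    using spectrum_real[OF A z(1)] by (metis complex_cnj_complex_of_real poly_map_poly_cnj)
  then have "complex_of_real ((norm (poly_op A p))\<^sup>2) = complex_of_real ((cmod (poly p z))\<^sup>2)"
    using z(2) unfolding r_def
    by (simp add: mult.commute complex_norm_square[symmetric] del: of_real_power)
  then have "(norm (poly_op A p))\<^sup>2 = (cmod (poly p z))\<^sup>2" by (simp only: of_real_eq_iff)
  then show ?thesis using z(1) by (auto simp: power2_eq_iff_nonneg)
qed

lemma norm_poly_op_le:
  fixes A :: "'h::chilbert_space \<Rightarrow>\<^sub>L 'h"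
  assumes A: "A \<in> BH_sa" and M: "\<And>z. z \<in> spectrum A \<Longrightarrow> cmod (poly p z) \<le> M" "0 \<le> M"
  shows "norm (poly_op A p) \<le> M"
proof (cases "poly_op A p = 0")
  case False
  then show ?thesis using norm_poly_op_attained[OF A, of p] M by (metis zero_less_norm_iff)
qed (use M in simp)


section \<open>Continuous functional calculus\<close>

text \<open>Because \<open>K\<close> is real, polynomials in z alone suffice: real and imaginary
  part are approximated within \<open>e / 2\<close> by real polynomials, which are recombined with
  the factor \<i>.\<close>

lemma complex_poly_dense:
  fixes f :: "complex \<Rightarrow> complex"
  assumes K: "compact K" "K \<subseteq> \<real>" and f: "continuous_on K f" and e: "0 < e"
  shows "\<exists>p. \<forall>z\<in>K. cmod (poly p z - f z) < e"
proof -
  define K0 where "K0 = Re ` K"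
  have K0: "compact K0" unfolding K0_def
    by (intro compact_continuous_image K continuous_intros)
  have K0K: "complex_of_real x \<in> K" if "x \<in> K0" for x
    using that K(2) by (auto simp: K0_def)
  have KK0: "Re z \<in> K0 \<and> z = complex_of_real (Re z)" if "z \<in> K" for z
    using that K(2) by (auto simp: K0_def)
  have cont: "continuous_on K0 (\<lambda>x. f (complex_of_real x))"
    by (intro continuous_on_compose2[OF f] continuous_intros) (use K0K in auto)
  have poly: "\<exists>p. \<forall>x. poly p (complex_of_real x) = complex_of_real (g x)"
    if "real_polynomial_function g" for g
  proof -
    obtain a n where "g = (\<lambda>x. \<Sum>i\<le>n. a i * x ^ i)"
      using \<open>real_polynomial_function g\<close> real_polynomial_function_iff_sum by metis
    then show ?thesis
      by (intro exI[of _ "\<Sum>i\<le>n. monom (complex_of_real (a i)) i"]) (simp add: poly_sum poly_monom)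
  qed
  obtain g1 where g1: "real_polynomial_function g1" "\<And>x. x \<in> K0 \<Longrightarrow> \<bar>Re (f (complex_of_real x)) - g1 x\<bar> < e / 2"
    using Stone_Weierstrass_real_polynomial_function[OF K0 continuous_on_Re[OF cont], of "e / 2"] e by auto
  obtain g2 where g2: "real_polynomial_function g2" "\<And>x. x \<in> K0 \<Longrightarrow> \<bar>Im (f (complex_of_real x)) - g2 x\<bar> < e / 2"
    using Stone_Weierstrass_real_polynomial_function[OF K0 continuous_on_Im[OF cont], of "e / 2"] e by auto
  obtain p1 where p1: "\<And>x. poly p1 (complex_of_real x) = complex_of_real (g1 x)" using poly[OF g1(1)] by blast
  obtain p2 where p2: "\<And>x. poly p2 (complex_of_real x) = complex_of_real (g2 x)" using poly[OF g2(1)] by blast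
  have "cmod (poly (p1 + smult \<i> p2) z - f z) < e" if "z \<in> K" for z
  proof -
    define x where "x = Re z"
    have z: "x \<in> K0" "z = complex_of_real x" using KK0[OF that] by (auto simp: x_def)
    define w where "w = poly (p1 + smult \<i> p2) z - f z"
    have "cmod w \<le> \<bar>Re w\<bar> + \<bar>Im w\<bar>" by (rule cmod_le)
    moreover have "Re w = g1 x - Re (f (complex_of_real x))" "Im w = g2 x - Im (f (complex_of_real x))"
      by (simp_all add: w_def z(2) p1 p2)
    ultimately have "cmod w < e" using g1(2)[OF z(1)] g2(2)[OF z(1)] by linarith
    then show ?thesis by (simp only: w_def)
  qed
  then show ?thesis by blast
qed

section \<open>The calculus as the closure of the polynomial calculus\<close>

lemma compact_spectrum:
  assumes A: "A \<in> BH_sa"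
  shows "compact (spectrum A)"
  using compact_UN_spectrum[of "{0::real}" "\<lambda>_. A"] A by simp

lemma spectrum_Reals: "A \<in> BH_sa \<Longrightarrow> spectrum A \<subseteq> \<real>"
  by (metis Reals_of_real spectrum_real subsetI)

text \<open>A relation rather than a function: algebraic rules pass to the limit without a choice of
  approximating polynomials, and the values of an arbitrary calculus can be shown to satisfy the
  same relation.\<close>

definition cfc_rel :: "('h::chilbert_space \<Rightarrow>\<^sub>L 'h) \<Rightarrow> (complex \<Rightarrow> complex) \<Rightarrow> ('h \<Rightarrow>\<^sub>L 'h) \<Rightarrow> bool" where
  "cfc_rel A f T \<longleftrightarrow> (\<exists>p. uniform_limit (spectrum A) (\<lambda>n. poly (p n)) f sequentially \<and>
     (\<lambda>n. poly_op A (p n)) \<longlonglongrightarrow> T)"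

lemma cfc_rel_poly: "cfc_rel A (poly p) (poly_op A p)"
  unfolding cfc_rel_def by (intro exI[of _ "\<lambda>_. p"]) (auto intro!: uniform_limitI)

text \<open>Together with \<open>cfc_rel_spectrum_le\<close> this is the isometry. Applied to
  differences it gives uniqueness and all later error estimates.\<close>

lemma cfc_rel_norm_le:
  assumes A: "A \<in> BH_sa" and T: "cfc_rel A f T" and M: "\<And>z. z \<in> spectrum A \<Longrightarrow> cmod (f z) \<le> M" "0 \<le> M"
  shows "norm T \<le> M"
proof (rule field_le_epsilon)
  fix e :: real assume e: "0 < e"
  obtain p where p: "uniform_limit (spectrum A) (\<lambda>n. poly (p n)) f sequentially"
    "(\<lambda>n. poly_op A (p n)) \<longlonglongrightarrow> T" using T by (auto simp: cfc_rel_def)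
  have "\<forall>\<^sub>F n in sequentially. norm (poly_op A (p n)) \<le> M + e"
    using uniform_limitD[OF p(1) e]
  proof eventually_elim
    case (elim n)
    show ?case
    proof (rule norm_poly_op_le[OF A])
      fix z assume z: "z \<in> spectrum A"
      show "cmod (poly (p n) z) \<le> M + e"
        using elim[rule_format, OF z] M(1)[OF z] norm_triangle_ineq2[of "poly (p n) z" "f z"]
        by (simp add: dist_norm)
    qed (use M e in simp)
  qed
  then show "norm T \<le> M + e" by (rule tendsto_upperbound[OF tendsto_norm[OF p(2)]]) simp
qed

lemma cfc_rel_spectrum_le:
  assumes A: "A \<in> BH_sa" and T: "cfc_rel A f T" and z: "z \<in> spectrum A"
  shows "cmod (f z) \<le> norm T"
proof -
  obtain p where p: "uniform_limit (spectrum A) (\<lambda>n. poly (p n)) f sequentially"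
    "(\<lambda>n. poly_op A (p n)) \<longlonglongrightarrow> T" using T by (auto simp: cfc_rel_def)
  show ?thesis
    by (rule tendsto_le[OF _ tendsto_norm[OF p(2)] tendsto_norm[OF tendsto_uniform_limitI[OF p(1) z]]])
      (auto simp: poly_spectrum_le[OF A z])
qed

lemma cfc_rel_BH:
  fixes A :: "'h::chilbert_space \<Rightarrow>\<^sub>L 'h"
  assumes A: "A \<in> BH_sa" and T: "cfc_rel A f T"
  shows "T \<in> BH"
proof -
  interpret sc: bounded_linear "\<lambda>x::'h. c *\<^sub>C x" for c by (rule bounded_linear_scaleC)
  obtain p where p: "(\<lambda>n. poly_op A (p n)) \<longlonglongrightarrow> T" using T by (auto simp: cfc_rel_def)
  have "T (c *\<^sub>C x) = c *\<^sub>C T x" for c x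
  proof (rule LIMSEQ_unique)
    show "(\<lambda>n. poly_op A (p n) (c *\<^sub>C x)) \<longlonglongrightarrow> T (c *\<^sub>C x)"
      by (intro blinfun.tendsto p tendsto_const)
    show "(\<lambda>n. poly_op A (p n) (c *\<^sub>C x)) \<longlonglongrightarrow> c *\<^sub>C T x"
      unfolding BH_scaleC[OF poly_op_BH[OF BH_sa_BH[OF A]]]
      by (intro sc.tendsto blinfun.tendsto p tendsto_const)
  qed
  then show ?thesis by (simp add: BH_def)
qed

lemma cfc_rel_bounded:
  assumes A: "A \<in> BH_sa" and T: "cfc_rel A f T"
  shows "bounded (f ` spectrum A)"
  using cfc_rel_spectrum_le[OF A T] by (auto simp: bounded_iff)

lemma cfc_rel_add:
  assumes "cfc_rel A f T" "cfc_rel A g U"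
  shows "cfc_rel A (\<lambda>z. f z + g z) (T + U)"
proof -
  obtain p q where p: "uniform_limit (spectrum A) (\<lambda>n. poly (p n)) f sequentially"
    "(\<lambda>n. poly_op A (p n)) \<longlonglongrightarrow> T" and q: "uniform_limit (spectrum A) (\<lambda>n. poly (q n)) g sequentially"
    "(\<lambda>n. poly_op A (q n)) \<longlonglongrightarrow> U" using assms by (auto simp: cfc_rel_def)
  have "(\<lambda>n. poly (p n + q n)) = (\<lambda>n z. poly (p n) z + poly (q n) z)" by (simp add: fun_eq_iff)
  then show ?thesis
    unfolding cfc_rel_def using uniform_limit_add[OF p(1) q(1)] tendsto_add[OF p(2) q(2)]
    by (intro exI[of _ "\<lambda>n. p n + q n"]) (simp add: poly_op_add)
qed

lemma cfc_rel_mult: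
  assumes A: "A \<in> BH_sa" and fg: "cfc_rel A f T" "cfc_rel A g U"
  shows "cfc_rel A (\<lambda>z. f z * g z) (T o\<^sub>L U)"
proof -
  obtain p q where p: "uniform_limit (spectrum A) (\<lambda>n. poly (p n)) f sequentially"
    "(\<lambda>n. poly_op A (p n)) \<longlonglongrightarrow> T" and q: "uniform_limit (spectrum A) (\<lambda>n. poly (q n)) g sequentially"
    "(\<lambda>n. poly_op A (q n)) \<longlonglongrightarrow> U" using fg by (auto simp: cfc_rel_def)
  have "(\<lambda>n. poly_op A (p n) o\<^sub>L poly_op A (q n)) \<longlonglongrightarrow> (T o\<^sub>L U)"
    by (intro bounded_bilinear.tendsto[OF bounded_bilinear_blinfun_compose] p q)
  moreover have "(\<lambda>n. poly (p n * q n)) = (\<lambda>n z. poly (p n) z * poly (q n) z)" by (simp add: fun_eq_iff)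
  ultimately show ?thesis
    unfolding cfc_rel_def
    using uniform_lim_mult[OF p(1) q(1) cfc_rel_bounded[OF A fg(1)] cfc_rel_bounded[OF A fg(2)]]
    by (intro exI[of _ "\<lambda>n. p n * q n"]) (simp add: poly_op_mult BH_sa_BH[OF A])
qed

lemma cfc_rel_cmult:
  assumes A: "A \<in> BH_sa" and f: "cfc_rel A f T"
  shows "cfc_rel A (\<lambda>z. c * f z) (scalar_op c o\<^sub>L T)"
  using cfc_rel_mult[OF A cfc_rel_poly[of A "[:c:]"] f] by simp

lemma cfc_rel_diff:
  assumes A: "A \<in> BH_sa" and "cfc_rel A f T" "cfc_rel A g U"
  shows "cfc_rel A (\<lambda>z. f z - g z) (T - U)"
proof -
  have "scalar_op (-1) o\<^sub>L U = - U"
    by (rule blinfun_eqI) (simp add: scaleC_minus_left blinfun.minus_left)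
  then show ?thesis
    using cfc_rel_add[OF assms(2) cfc_rel_cmult[OF A assms(3), of "-1"]] by simp
qed

lemma cfc_rel_unique:
  assumes A: "A \<in> BH_sa" and T: "cfc_rel A f T" and U: "cfc_rel A g U"
    and eq: "\<And>z. z \<in> spectrum A \<Longrightarrow> f z = g z"
  shows "T = U"
proof -
  have "norm (T - U) \<le> 0"
    by (rule cfc_rel_norm_le[OF A cfc_rel_diff[OF A T U]]) (simp_all add: eq)
  then show ?thesis by simp
qed

text \<open>The polynomials witnessing \<open>T\<close> are reused for \<open>U\<close>: on the real
  spectrum their conjugates approximate \<open>cnj (f z)\<close>, so by
  \<open>cfc_rel_norm_le\<close> the conjugate polynomials of \<open>A\<close> converge to
  \<open>U\<close>, and \<open>poly_op_cinner\<close> passes to the limit.\<close>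

lemma cfc_rel_adjoint:
  fixes A :: "'h::chilbert_space \<Rightarrow>\<^sub>L 'h"
  assumes A: "A \<in> BH_sa" and T: "cfc_rel A f T"
    and U: "cfc_rel A (\<lambda>z. cnj (f z)) U"
  shows "cinner (blinfun_apply T x) y = cinner x (blinfun_apply U y)"
proof -
  interpret ci: bounded_bilinear "cinner :: 'h \<Rightarrow> 'h \<Rightarrow> complex" by (rule bounded_bilinear_cinner)
  obtain p where p: "uniform_limit (spectrum A) (\<lambda>n. poly (p n)) f sequentially"
    "(\<lambda>n. poly_op A (p n)) \<longlonglongrightarrow> T" using T by (auto simp: cfc_rel_def)
  have cnj: "cnj z = z" if "z \<in> spectrum A" for z
    using spectrum_real[OF A that] by (metis complex_cnj_complex_of_real)
  have "(\<lambda>n. poly_op A (map_poly cnj (p n))) \<longlonglongrightarrow> U"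
  proof (rule tendstoI)
    fix e :: real assume e: "0 < e"
    have "\<forall>\<^sub>F n in sequentially. norm (poly_op A (map_poly cnj (p n)) - U) \<le> e / 2"
      using uniform_limitD[OF p(1), of "e / 2"] e
    proof (auto elim!: eventually_mono)
      fix n assume n: "\<forall>z\<in>spectrum A. dist (poly (p n) z) (f z) * 2 < e"
      have "norm (poly_op A (map_poly cnj (p n)) - U) \<le> e / 2"
      proof (rule cfc_rel_norm_le[OF A cfc_rel_diff[OF A cfc_rel_poly U]])
        fix z assume z: "z \<in> spectrum A"
        have "cmod (cnj (poly (p n) z - f z)) \<le> e / 2"
          using n z unfolding complex_mod_cnj by (auto simp: dist_norm less_imp_le)
        then show "cmod (poly (map_poly cnj (p n)) z - cnj (f z)) \<le> e / 2"
          by (simp add: cnj[OF z])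
      qed (use e in simp)
      then show "norm (poly_op A (map_poly cnj (p n)) - U) * 2 \<le> e" by simp
    qed
    then show "\<forall>\<^sub>F n in sequentially. dist (poly_op A (map_poly cnj (p n))) U < e"
      by (rule eventually_mono) (use e in \<open>auto simp: dist_norm\<close>)
  qed
  then have "(\<lambda>n. cinner x (poly_op A (map_poly cnj (p n)) y)) \<longlonglongrightarrow> cinner x (U y)"
    by (intro ci.tendsto blinfun.tendsto tendsto_const)
  moreover have "(\<lambda>n. cinner (poly_op A (p n) x) y) \<longlonglongrightarrow> cinner (T x) y"
    by (intro ci.tendsto blinfun.tendsto tendsto_const p)
  ultimately show ?thesis
    unfolding poly_op_cinner[OF A] by (rule LIMSEQ_unique[rotated])
qed

text \<open>Polynomials converging uniformly on the spectrum give a Cauchy sequence of operators by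
  \<open>norm_poly_op_le\<close>, and the operator space is complete.\<close>

lemma cfc_rel_exists:
  assumes A: "A \<in> BH_sa" and f: "continuous_on (spectrum A) f"
  shows "\<exists>T. cfc_rel A f T"
proof -
  have "\<forall>n. \<exists>p. \<forall>z\<in>spectrum A. cmod (poly p z - f z) < 1 / real (Suc n)"
    by (intro allI complex_poly_dense compact_spectrum spectrum_Reals A f) simp
  then obtain p where p: "\<And>n z. z \<in> spectrum A \<Longrightarrow> cmod (poly (p n) z - f z) < 1 / real (Suc n)"
    by metis
  have small: "\<exists>N. \<forall>n\<ge>N. 1 / real (Suc n) < e" if "e > 0" for e
    using LIMSEQ_inverse_real_of_nat[THEN order_tendstoD(2), OF that]
    by (simp add: eventually_sequentially inverse_eq_divide)
  have ul: "uniform_limit (spectrum A) (\<lambda>n. poly (p n)) f sequentially"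
    unfolding uniform_limit_sequentially_iff dist_norm
  proof (intro allI impI)
    fix e :: real assume "0 < e"
    then obtain N where N: "\<And>n. n \<ge> N \<Longrightarrow> 1 / real (Suc n) < e" using small by blast
    show "\<exists>N. \<forall>n\<ge>N. \<forall>z\<in>spectrum A. cmod (poly (p n) z - f z) < e"
      by (intro exI[of _ N] allI impI ballI) (rule less_trans[OF p N])
  qed
  have "Cauchy (\<lambda>n. poly_op A (p n))"
  proof (rule CauchyI)
    fix e :: real assume "0 < e"
    then obtain N where N: "\<And>n. n \<ge> N \<Longrightarrow> 1 / real (Suc n) < e / 3" using small[of "e / 3"] by auto
    have "norm (poly_op A (p m) - poly_op A (p n)) < e" if "m \<ge> N" "n \<ge> N" for m n
    proof -
      have "norm (poly_op A (p m - p n)) \<le> 2 * (e / 3)"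
      proof (rule norm_poly_op_le[OF A])
        fix z assume z: "z \<in> spectrum A"
        have "cmod (poly (p m - p n) z) = cmod ((poly (p m) z - f z) - (poly (p n) z - f z))" by simp
        also have "\<dots> \<le> cmod (poly (p m) z - f z) + cmod (poly (p n) z - f z)" by (rule norm_triangle_ineq4)
        also have "\<dots> \<le> 2 * (e / 3)" using p[OF z, of m] p[OF z, of n] N[OF that(1)] N[OF that(2)] by simp
        finally show "cmod (poly (p m - p n) z) \<le> 2 * (e / 3)" .
      qed (use \<open>0 < e\<close> in simp)
      then show ?thesis using \<open>0 < e\<close> by (simp add: poly_op_diff BH_sa_BH[OF A])
    qed
    then show "\<exists>N. \<forall>m\<ge>N. \<forall>n\<ge>N. norm (poly_op A (p m) - poly_op A (p n)) < e" by blast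
  qed
  then obtain T where "(\<lambda>n. poly_op A (p n)) \<longlonglongrightarrow> T"
    using Cauchy_convergent convergent_def by blast
  then show ?thesis using ul by (auto simp: cfc_rel_def)
qed

definition cfc :: "('h::chilbert_space \<Rightarrow>\<^sub>L 'h) \<Rightarrow> (complex \<Rightarrow> complex) \<Rightarrow> ('h \<Rightarrow>\<^sub>L 'h)" where
  "cfc A f = (SOME T. cfc_rel A f T)"

lemma cfc_rel_cfc: "A \<in> BH_sa \<Longrightarrow> continuous_on (spectrum A) f \<Longrightarrow> cfc_rel A f (cfc A f)"
  unfolding cfc_def by (rule someI_ex[OF cfc_rel_exists])

lemma is_functional_calculus_cfc:
  assumes A: "A \<in> BH_sa"
  shows "is_functional_calculus A (cfc A)"
  unfolding is_functional_calculus_def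
proof (intro conjI allI impI)
  fix f :: "complex \<Rightarrow> complex" assume f: "continuous_on (spectrum A) f"
  note rel = cfc_rel_cfc[OF A f]
  show "cfc A f \<in> BH" by (rule cfc_rel_BH[OF A rel])
  show "cinner (cfc A f x) y = cinner x (cfc A (\<lambda>z. cnj (f z)) y)" for x y
    by (intro cfc_rel_adjoint[OF A rel] cfc_rel_cfc A continuous_on_cnj f)
  show "norm (cfc A f) = Sup (insert 0 ((\<lambda>z. cmod (f z)) ` spectrum A))"
  proof (rule sym, rule cSup_eq)
    fix x assume "x \<in> insert 0 ((\<lambda>z. cmod (f z)) ` spectrum A)"
    then show "x \<le> norm (cfc A f)" using cfc_rel_spectrum_le[OF A rel] by auto
  next
    fix M assume "\<And>x. x \<in> insert 0 ((\<lambda>z. cmod (f z)) ` spectrum A) \<Longrightarrow> x \<le> M"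
    then show "norm (cfc A f) \<le> M" by (intro cfc_rel_norm_le[OF A rel]) auto
  qed
next
  fix f g :: "complex \<Rightarrow> complex" assume fg: "continuous_on (spectrum A) f" "continuous_on (spectrum A) g"
  note rel = cfc_rel_cfc[OF A fg(1)] cfc_rel_cfc[OF A fg(2)]
  have "cfc A (\<lambda>z. \<alpha> * f z + \<beta> * g z) = (scalar_op \<alpha> o\<^sub>L cfc A f) + (scalar_op \<beta> o\<^sub>L cfc A g)" for \<alpha> \<beta>
    by (rule cfc_rel_unique[OF A cfc_rel_cfc[OF A] cfc_rel_add[OF cfc_rel_cmult[OF A rel(1)] cfc_rel_cmult[OF A rel(2)]]])
      (auto intro!: continuous_intros fg)
  then show "cfc A (\<lambda>z. \<alpha> * f z + \<beta> * g z) x = \<alpha> *\<^sub>C cfc A f x + \<beta> *\<^sub>C cfc A g x" for \<alpha> \<beta> x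
    by (simp add: blinfun.add_left)
  show "cfc A (\<lambda>z. f z * g z) = cfc A f o\<^sub>L cfc A g"
    by (rule cfc_rel_unique[OF A cfc_rel_cfc[OF A] cfc_rel_mult[OF A rel]]) (auto intro!: continuous_intros fg)
next
  have "cfc A (\<lambda>z. 1) = poly_op A [:1:]"
    by (rule cfc_rel_unique[OF A cfc_rel_cfc[OF A] cfc_rel_poly]) auto
  also have "\<dots> = id_blinfun" by (rule blinfun_eqI) (simp add: blinfun.add_left)
  finally show "cfc A (\<lambda>z. 1) = id_blinfun" .
  have "cfc A (\<lambda>z. z) = poly_op A [:0, 1:]"
    by (rule cfc_rel_unique[OF A cfc_rel_cfc[OF A] cfc_rel_poly]) auto
  then show "cfc A (\<lambda>z. z) = A" by (simp only: poly_op_X)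
qed

section \<open>Uniqueness of the functional calculus\<close>

lemma is_functional_calculusD:
  assumes "is_functional_calculus A Phi" "continuous_on (spectrum A) f" "continuous_on (spectrum A) g"
  shows "blinfun_apply (Phi (\<lambda>z. \<alpha> * f z + \<beta> * g z)) x
      = \<alpha> *\<^sub>C blinfun_apply (Phi f) x + \<beta> *\<^sub>C blinfun_apply (Phi g) x"
    and "Phi (\<lambda>z. f z * g z) = Phi f o\<^sub>L Phi g"
    and "norm (Phi f) = Sup (insert 0 ((\<lambda>z. cmod (f z)) ` spectrum A))"
    and "Phi (\<lambda>z. 1) = id_blinfun"
    and "Phi (\<lambda>z. z) = A"
  using assms unfolding is_functional_calculus_def by blast+

lemma is_functional_calculus_poly:
  assumes Phi: "is_functional_calculus A Phi"
  shows "Phi (poly p) = poly_op A p"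
proof (induction p)
  case 0
  \<comment> \<open>Linearity of \<open>Phi\<close> is available only for combinations of two
    functions, so the zero function is written as such a combination.\<close>
  have "Phi (\<lambda>z. 0 * 1 + 0 * 1) x = 0 *\<^sub>C Phi (\<lambda>z. 1) x + 0 *\<^sub>C Phi (\<lambda>z. 1) x" for x
    by (rule is_functional_calculusD(1)[OF Phi]) (intro continuous_intros)+
  then show ?case by (intro blinfun_eqI) simp
next
  case (pCons a p)
  have cont: "continuous_on (spectrum A) (poly q)" for q by (intro continuous_intros)
  have "Phi (\<lambda>z. z * poly p z) = Phi (\<lambda>z. z) o\<^sub>L Phi (poly p)"
    by (rule is_functional_calculusD(2)[OF Phi]) (intro continuous_intros)+
  then have m: "Phi (\<lambda>z. z * poly p z) = A o\<^sub>L poly_op A p"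
    unfolding is_functional_calculusD(5)[OF Phi cont cont] pCons.IH .
  have "Phi (\<lambda>z. a * 1 + 1 * (z * poly p z)) x = a *\<^sub>C Phi (\<lambda>z. 1) x + 1 *\<^sub>C Phi (\<lambda>z. z * poly p z) x" for x
    by (rule is_functional_calculusD(1)[OF Phi]) (intro continuous_intros)+
  moreover note is_functional_calculusD(4)[OF Phi cont cont]
  moreover have "poly (pCons a p) = (\<lambda>z. a * 1 + 1 * (z * poly p z))" by auto
  ultimately show ?case by (intro blinfun_eqI) (simp add: m blinfun.add_left)
qed

text \<open>Any calculus agrees with \<open>poly_op\<close> on polynomials, and its isometry clause
  on f - q carries this over to limits. With \<open>cfc_rel_unique\<close>, any two calculi agree on
  continuous functions.\<close>

lemma is_functional_calculus_cfc_rel: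
  assumes A: "A \<in> BH_sa" and Phi: "is_functional_calculus A Phi" and f: "continuous_on (spectrum A) f"
  shows "cfc_rel A f (Phi f)"
proof -
  obtain T p where p: "uniform_limit (spectrum A) (\<lambda>n. poly (p n)) f sequentially"
    using cfc_rel_exists[OF A f] by (auto simp: cfc_rel_def)
  have bound: "norm (Phi f - poly_op A q) \<le> e"
    if q: "\<And>z. z \<in> spectrum A \<Longrightarrow> dist (poly q z) (f z) < e" and e: "0 < e" for q e
  proof -
    define g where "g = (\<lambda>z. 1 * f z + (-1) * poly q z)"
    have cq: "continuous_on (spectrum A) (poly q)" by (intro continuous_intros)
    have cg: "continuous_on (spectrum A) g" unfolding g_def by (intro continuous_intros f)
    have "Phi g x = 1 *\<^sub>C Phi f x + (-1) *\<^sub>C Phi (poly q) x" for x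
      unfolding g_def by (rule is_functional_calculusD(1)[OF Phi f cq])
    then have "Phi g = Phi f - poly_op A q"
      by (intro blinfun_eqI)
        (simp add: is_functional_calculus_poly[OF Phi] blinfun.diff_left scaleC_minus_left)
    moreover have "norm (Phi g) = Sup (insert 0 ((\<lambda>z. cmod (g z)) ` spectrum A))"
      by (rule is_functional_calculusD(3)[OF Phi cg cg])
    moreover have "\<dots> \<le> e"
    proof (rule cSup_least)
      fix x assume "x \<in> insert 0 ((\<lambda>z. cmod (g z)) ` spectrum A)"
      then show "x \<le> e" using q e
        by (auto simp: g_def dist_norm norm_minus_commute intro: less_imp_le)
    qed simp
    ultimately show ?thesis by simp
  qed
  have "(\<lambda>n. poly_op A (p n)) \<longlonglongrightarrow> Phi f"
  proof (rule tendstoI)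
    fix e :: real assume e: "0 < e"
    show "\<forall>\<^sub>F n in sequentially. dist (poly_op A (p n)) (Phi f) < e"
      using uniform_limitD[OF p, of "e / 2"]
    proof (rule eventually_mono)
      fix n assume "\<forall>x\<in>spectrum A. dist (poly (p n) x) (f x) < e / 2"
      then have "norm (Phi f - poly_op A (p n)) \<le> e / 2" using e by (intro bound) auto
      then show "dist (poly_op A (p n)) (Phi f) < e" using e
        by (simp add: dist_norm norm_minus_commute)
    qed (use e in simp)
  qed
  then show ?thesis using p by (auto simp: cfc_rel_def)
qed

text \<open>Discharges the description in \<open>fun_op\<close>: \<open>cfc\<close> is a witness,
  and every other calculus yields the same operator. The properties of f(A) below are derived from
  this relation.\<close>

lemma cfc_rel_fun_op:
  assumes A: "A \<in> BH_sa" and f: "continuous_on I f" and sub: "spectrum A \<subseteq> complex_of_real ` I"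
  shows "cfc_rel A (\<lambda>z. complex_of_real (f (Re z))) (fun_op f A)"
proof -
  have cont: "continuous_on (spectrum A) (\<lambda>z. complex_of_real (f (Re z)))"
    by (intro continuous_on_of_real continuous_on_compose2[OF f] continuous_intros) (use sub in auto)
  note rel = is_functional_calculus_cfc_rel[OF A _ cont]
  have "fun_op f A = cfc A (\<lambda>z. complex_of_real (f (Re z)))"
    unfolding fun_op_def
  proof (rule the_equality)
    show "\<exists>Phi. is_functional_calculus A Phi \<and>
        cfc A (\<lambda>z. complex_of_real (f (Re z))) = Phi (\<lambda>z. complex_of_real (f (Re z)))"
      using is_functional_calculus_cfc[OF A] by blast
  next
    fix T assume "\<exists>Phi. is_functional_calculus A Phi \<and> T = Phi (\<lambda>z. complex_of_real (f (Re z)))"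
    then show "T = cfc A (\<lambda>z. complex_of_real (f (Re z)))"
      using cfc_rel_unique[OF A rel cfc_rel_cfc[OF A cont]] by blast
  qed
  then show ?thesis using cfc_rel_cfc[OF A cont] by simp
qed

text \<open>A real-valued function is its own conjugate, so \<open>cfc_rel_adjoint\<close> applies
  with both operators equal.\<close>

lemma fun_op_BH_sa:
  assumes A: "A \<in> BH_sa" and f: "continuous_on I f" and sub: "spectrum A \<subseteq> complex_of_real ` I"
  shows "fun_op f A \<in> BH_sa"
  using cfc_rel_BH[OF A cfc_rel_fun_op[OF assms]]
    cfc_rel_adjoint[OF A cfc_rel_fun_op[OF assms]] cfc_rel_fun_op[OF assms]
  by (simp add: BH_sa_def)

text \<open>Positivity: \<open>f(A) = g(A)\<^sup>* g(A)\<close> for \<open>g = sqrt f\<close>.\<close>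

lemma fun_op_nonneg:
  assumes A: "A \<in> BH_sa" and f: "continuous_on I f" and sub: "spectrum A \<subseteq> complex_of_real ` I"
    and pos: "\<forall>r\<in>I. 0 \<le> f r"
  shows "0 \<le> Re (cinner (blinfun_apply (fun_op f A) x) x)"
proof -
  define g where "g r = sqrt (f r)" for r
  have g: "continuous_on I g" unfolding g_def by (intro continuous_intros f)
  have "fun_op f A = fun_op g A o\<^sub>L fun_op g A"
  proof (rule cfc_rel_unique[OF A cfc_rel_fun_op[OF A f sub]
        cfc_rel_mult[OF A cfc_rel_fun_op[OF A g sub] cfc_rel_fun_op[OF A g sub]]])
    fix z assume "z \<in> spectrum A"
    then have "Re z \<in> I" using sub by auto
    then show "complex_of_real (f (Re z)) = complex_of_real (g (Re z)) * complex_of_real (g (Re z))"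
      using pos by (simp add: g_def flip: of_real_mult)
  qed
  then have "cinner (fun_op f A x) x = cinner (fun_op g A x) (fun_op g A x)"
    using BH_sa_cinner[OF fun_op_BH_sa[OF A g sub]] by simp
  then show ?thesis by (simp add: cinner_ge_zero)
qed

lemma continuous_on_poly_op:
  "continuous_on K F \<Longrightarrow> continuous_on K (\<lambda>s. poly_op (F s) p)"
  by (induction p)
    (auto intro!: continuous_intros bounded_bilinear.continuous_on[OF bounded_bilinear_blinfun_compose])

lemma continuous_on_fun_op:
  fixes F :: "'a::metric_space \<Rightarrow> ('h::chilbert_space \<Rightarrow>\<^sub>L 'h)"
  assumes K: "compact K" and F: "continuous_on K F" "\<And>s. s \<in> K \<Longrightarrow> F s \<in> BH_sa"
    and f: "continuous_on I f" and sub: "\<And>s. s \<in> K \<Longrightarrow> spectrum (F s) \<subseteq> complex_of_real ` I"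
  shows "continuous_on K (\<lambda>s. fun_op f (F s))"
proof -
  define L where "L = (\<Union>s\<in>K. spectrum (F s))"
  have L: "compact L" unfolding L_def by (rule compact_UN_spectrum[OF F K])
  have LI: "L \<subseteq> complex_of_real ` I" using sub by (auto simp: L_def)
  have cont: "continuous_on L (\<lambda>z. complex_of_real (f (Re z)))"
    by (intro continuous_on_of_real continuous_on_compose2[OF f] continuous_intros) (use LI in auto)
  have "\<exists>p. \<forall>z\<in>L. cmod (poly p z - complex_of_real (f (Re z))) < 1 / real (Suc n)" for n
    by (rule complex_poly_dense[OF L _ cont]) (use LI in auto)
  then obtain p where p: "\<And>n z. z \<in> L \<Longrightarrow> cmod (poly (p n) z - complex_of_real (f (Re z))) < 1 / real (Suc n)"
    by metis
  have "uniform_limit K (\<lambda>n s. poly_op (F s) (p n)) (\<lambda>s. fun_op f (F s)) sequentially"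
  proof (rule uniform_limitI)
    fix e :: real assume e: "0 < e"
    have "\<forall>\<^sub>F n in sequentially. 1 / real (Suc n) < e"
      using order_tendstoD(2)[OF LIMSEQ_inverse_real_of_nat e] by (simp add: inverse_eq_divide)
    then show "\<forall>\<^sub>F n in sequentially. \<forall>s\<in>K. dist (poly_op (F s) (p n)) (fun_op f (F s)) < e"
    proof (rule eventually_mono, intro ballI)
      fix n s assume n: "1 / real (Suc n) < e" and s: "s \<in> K"
      note A = F(2)[OF s]
      have "norm (poly_op (F s) (p n) - fun_op f (F s)) \<le> 1 / real (Suc n)"
      proof (rule cfc_rel_norm_le[OF A cfc_rel_diff[OF A cfc_rel_poly cfc_rel_fun_op[OF A f sub[OF s]]]])
        fix z assume "z \<in> spectrum (F s)"
        then have "z \<in> L" using s by (auto simp: L_def)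
        then show "cmod (poly (p n) z - complex_of_real (f (Re z))) \<le> 1 / real (Suc n)"
          using p[of z n] by simp
      qed simp
      then show "dist (poly_op (F s) (p n)) (fun_op f (F s)) < e" using n by (simp add: dist_norm)
    qed
  qed
  then show ?thesis
    by (rule uniform_limit_theorem[rotated]) (auto intro!: always_eventually continuous_on_poly_op F)
qed


section \<open>The trapezoid inequality\<close>

text \<open>Splitting at the midpoint removes the absolute value. The \<open>q\<close> part is odd
  about \<open>m\<close> and cancels; the \<open>p\<close> part gives \<open>p\<close> times the
  integral of \<open>\<bar>t - m\<bar>\<close>.\<close>

lemma has_integral_abs_times_affine:
  fixes a b p q :: real
  assumes "a < b"
  defines "m \<equiv> (a + b) / 2"
  shows "((\<lambda>t. \<bar>t - m\<bar> * (p + q * (t - m))) has_integral (p * (b - a)\<^sup>2 / 4)) {a..b}"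
proof -
  have m: "a \<le> m" "m \<le> b" using assms by (auto simp: m_def)
  let ?F = "\<lambda>t. p * (t - m)\<^sup>2 / 2 + q * (t - m)^3 / 3"
  have deriv: "(?F has_vector_derivative (t - m) * (p + q * (t - m))) (at t within K)" for t K
    unfolding has_real_derivative_iff_has_vector_derivative[symmetric]
    by (auto intro!: derivative_eq_intros simp: field_simps power2_eq_square)
  have "((\<lambda>t. (t - m) * (p + q * (t - m))) has_integral (?F b - ?F m)) {m..b}"
    by (rule fundamental_theorem_of_calculus[OF m(2)]) (rule deriv)
  then have right: "((\<lambda>t. \<bar>t - m\<bar> * (p + q * (t - m))) has_integral (?F b - ?F m)) {m..b}"
    by (rule has_integral_eq[rotated]) auto
  have "((\<lambda>t. (t - m) * (p + q * (t - m))) has_integral (?F m - ?F a)) {a..m}"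
    by (rule fundamental_theorem_of_calculus[OF m(1)]) (rule deriv)
  then have "((\<lambda>t. - ((t - m) * (p + q * (t - m)))) has_integral - (?F m - ?F a)) {a..m}"
    by (rule has_integral_neg)
  then have left: "((\<lambda>t. \<bar>t - m\<bar> * (p + q * (t - m))) has_integral - (?F m - ?F a)) {a..m}"
    by (rule has_integral_eq[rotated]) (auto simp: algebra_simps)
  have "- (?F m - ?F a) + (?F b - ?F m) = p * (b - a)\<^sup>2 / 4"
    by (simp add: m_def power2_eq_square power3_eq_cube field_simps)
  then show ?thesis using has_integral_combine[OF m left right] by (simp only:)
qed

text \<open>Integration by parts turns the trapezoid error of \<open>t \<mapsto> \<integral>\<^sub>0\<^sup>t g\<close> into
  \<open>\<integral>\<^sub>a\<^sup>b (t - (a + b) / 2) g(t) dt / (b - a)\<close>; convexity bounds \<open>g\<close> by its chord.\<close>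

lemma convex_trapezoid:
  fixes g :: "real \<Rightarrow> real"
  assumes cont: "continuous_on {0..1} g"
    and pos: "\<And>s. s \<in> {0..1} \<Longrightarrow> 0 \<le> g s"
    and conv: "\<And>u v t. u \<in> {0..1} \<Longrightarrow> v \<in> {0..1} \<Longrightarrow> t \<in> {0..1} \<Longrightarrow>
      g (u + t * (v - u)) \<le> (1 - t) * g u + t * g v"
    and ab: "0 \<le> a" "a < b" "b \<le> 1"
  shows "\<bar>1 / 2 * integral {0..a} g + 1 / 2 * integral {0..b} g
      - 1 / (b - a) * integral {a..b} (\<lambda>t. integral {0..t} g)\<bar> \<le> (b - a) / 8 * (g a + g b)"
proof -
  define m where "m = (a + b) / 2"
  define G where "G t = integral {0..t} g" for t
  have sub: "{a..b} \<subseteq> {0..1}" using ab by auto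
  have G': "(G has_vector_derivative g t) (at t within {a..b})" if "t \<in> {a..b}" for t
    unfolding G_def
    by (rule has_vector_derivative_within_subset[OF integral_has_vector_derivative[OF cont] sub])
      (use that sub in auto)
  have contG: "continuous_on {a..b} G"
    unfolding continuous_on_eq_continuous_within
    by (intro ballI has_vector_derivative_continuous[OF G'])
  have contg: "continuous_on {a..b} g" by (rule continuous_on_subset[OF cont sub])
  \<comment> \<open>The primitive of the constant 1 is normalized to vanish at the midpoint, so that
    the boundary terms are exactly the trapezoid \<open>(b - a) / 2 * (G a + G b)\<close>.\<close>
  have "((\<lambda>t. (t - m) * G t) has_vector_derivative ((t - m) * g t + G t)) (at t within {a..b})"
    if "t \<in> {a..b}" for t
    using G'[OF that] unfolding has_real_derivative_iff_has_vector_derivative[symmetric]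
    by (auto intro!: derivative_eq_intros)
  then have "((\<lambda>t. (t - m) * g t + G t) has_integral ((b - m) * G b - (a - m) * G a)) {a..b}"
    by (intro fundamental_theorem_of_calculus) (use ab in auto)
  then have parts: "integral {a..b} (\<lambda>t. (t - m) * g t) + integral {a..b} G = (b - m) * G b - (a - m) * G a"
    by (subst integral_add[symmetric])
      (auto intro!: integrable_continuous_interval continuous_intros contG contg simp: has_integral_iff)
  define E where "E = 1 / 2 * G a + 1 / 2 * G b - 1 / (b - a) * integral {a..b} G"
  have "(b - a) * E = (b - a) / 2 * (G a + G b) - integral {a..b} G"
    using ab by (simp add: E_def field_simps)
  moreover have "(b - m) * G b - (a - m) * G a = (b - a) / 2 * (G a + G b)"
    by (simp add: m_def field_simps)
  ultimately have E: "(b - a) * E = integral {a..b} (\<lambda>t. (t - m) * g t)"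
    using parts by linarith
  \<comment> \<open>The chord in centred form: \<open>p\<close> is its value at the midpoint,
    \<open>q\<close> its slope.\<close>
  define p where "p = (g a + g b) / 2"
  define q where "q = (g b - g a) / (b - a)"
  have aff: "((\<lambda>t. \<bar>t - m\<bar> * (p + q * (t - m))) has_integral (p * (b - a)\<^sup>2 / 4)) {a..b}"
    unfolding m_def by (rule has_integral_abs_times_affine[OF ab(2)])
  have chord: "g t \<le> p + q * (t - m)" if t: "t \<in> {a..b}" for t
  proof -
    define l where "l = (t - a) / (b - a)"
    have l: "l \<in> {0..1}" "a + l * (b - a) = t" using t ab by (auto simp: l_def)
    then have "g t \<le> (1 - l) * g a + l * g b" using conv[of a b l] ab by auto
    also have "\<dots> = p + q * (t - m)"
    proof -
      have gb: "g b = g a + q * (b - a)" using ab by (simp add: q_def)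
      show ?thesis unfolding p_def m_def l(2)[symmetric] gb by (simp add: field_simps)
    qed
    finally show ?thesis .
  qed
  have "norm (integral {a..b} (\<lambda>t. (t - m) * g t)) \<le> integral {a..b} (\<lambda>t. \<bar>t - m\<bar> * (p + q * (t - m)))"
  proof (rule integral_norm_bound_integral)
    show "(\<lambda>t. (t - m) * g t) integrable_on {a..b}"
      by (intro integrable_continuous_interval continuous_intros contg)
    show "(\<lambda>t. \<bar>t - m\<bar> * (p + q * (t - m))) integrable_on {a..b}" using aff by blast
    fix t assume t: "t \<in> {a..b}"
    then have "0 \<le> g t" using pos sub by auto
    then show "norm ((t - m) * g t) \<le> \<bar>t - m\<bar> * (p + q * (t - m))"
      using chord[OF t] by (simp add: abs_mult mult_left_mono)
  qed
  also have "\<dots> = (b - a) * ((b - a) / 8 * (g a + g b))"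
    using integral_unique[OF aff] by (simp add: p_def power2_eq_square field_simps)
  finally have "\<bar>(b - a) * E\<bar> \<le> (b - a) * ((b - a) / 8 * (g a + g b))" by (simp add: E)
  then have "\<bar>E\<bar> \<le> (b - a) / 8 * (g a + g b)" using ab by (simp add: abs_mult)
  then show ?thesis unfolding E_def G_def[abs_def] .
qed


section \<open>The path between two operators\<close>

text \<open>On the path, condition C makes \<open>\<eta>\<close> the difference of parameters, so that preinvexity along it
  is ordinary convexity in the parameter.\<close>

lemma condition_C_path:
  assumes C: "condition_C S \<eta>" and S: "invex S \<eta>" and AB: "A \<in> S" "B \<in> S"
    and uv: "u \<in> {0..1}" "v \<in> {0..1}"
  shows "\<eta> (A + v *\<^sub>R \<eta> B A) (A + u *\<^sub>R \<eta> B A) = (v - u) *\<^sub>R \<eta> B A"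
proof -
  let ?P = "\<lambda>s. A + s *\<^sub>R \<eta> B A"
  have inS: "?P s \<in> S" if "s \<in> {0..1}" for s using S AB that by (auto simp: invex_def)
  have C1: "\<eta> y (y + t *\<^sub>R \<eta> x y) = - (t *\<^sub>R \<eta> x y)" and C2: "\<eta> x (y + t *\<^sub>R \<eta> x y) = (1 - t) *\<^sub>R \<eta> x y"
    if "x \<in> S" "y \<in> S" "t \<in> {0..1}" for x y t
    using C that by (auto simp: condition_C_def)
  have less: "\<eta> (?P v) (?P u) = (v - u) *\<^sub>R \<eta> B A \<and> \<eta> (?P u) (?P v) = (u - v) *\<^sub>R \<eta> B A"
    if uv: "u \<in> {0..1}" "v \<in> {0..1}" "u < v" for u v
  proof -
    \<comment> \<open>From parameter \<open>u\<close> the direction towards \<open>B\<close> has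
      length \<open>1 - u\<close> in units of \<open>\<eta> B A\<close>; the fraction
      \<open>t\<close> of it ends at \<open>v\<close>.\<close>
    define t where "t = (v - u) / (1 - u)"
    have t: "t \<in> {0..1}" "t * (1 - u) = v - u" using uv by (auto simp: t_def)
    have "\<eta> B (?P u) = (1 - u) *\<^sub>R \<eta> B A" using C2[OF AB(2,1) uv(1)] .
    then have step: "t *\<^sub>R \<eta> B (?P u) = (v - u) *\<^sub>R \<eta> B A" using t by simp
    have v: "?P u + t *\<^sub>R \<eta> B (?P u) = ?P v" unfolding step by (simp add: algebra_simps)
    have rev: "\<eta> (?P u) (?P v) = (u - v) *\<^sub>R \<eta> B A"
      using C1[OF AB(2) inS[OF uv(1)] t(1)] unfolding v step by (simp add: algebra_simps)
    \<comment> \<open>The forward value comes from the backward one: by \<open>rev\<close> the full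
      step from \<open>?P v\<close> ends at \<open>?P u\<close>, so the first identity of condition
      C with parameter 1 reverses the sign.\<close>
    have u: "?P v + 1 *\<^sub>R \<eta> (?P u) (?P v) = ?P u" unfolding rev by (simp add: algebra_simps)
    have "\<eta> (?P v) (?P u) = (v - u) *\<^sub>R \<eta> B A"
      using C1[OF inS[OF uv(1)] inS[OF uv(2)], of 1] unfolding u by (simp add: rev algebra_simps)
    with rev show ?thesis by simp
  qed
  consider "u < v" | "v < u" | "u = v" by linarith
  then show ?thesis
  proof cases
    case 3
    \<comment> \<open>Parameter 0 in the first identity of condition C makes \<open>\<eta>\<close>
      vanish on the diagonal.\<close>
    then show ?thesis using C1[OF inS[OF uv(1)] inS[OF uv(1)], of 0] by simp
  qed (use less[of u v] less[of v u] uv in auto)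
qed

lemma operator_preinvexD:
  assumes "operator_preinvex I f \<eta> S" "C \<in> S" "D \<in> S" "t \<in> {0..1}"
  shows "spectrum (C + t *\<^sub>R \<eta> D C) \<subseteq> complex_of_real ` I"
    and "fun_op f (C + t *\<^sub>R \<eta> D C) \<le>\<^sub>o\<^sub>p (1 - t) *\<^sub>R fun_op f C + t *\<^sub>R fun_op f D"
  using assms unfolding operator_preinvex_def by simp_all


section \<open>Integrals of selfadjoint operators\<close>

text \<open>Complex linearity and selfadjointness are equations between bounded linear maps of the
  operator, evaluated at fixed vectors; such maps commute with the integral.\<close>

lemma integral_BH_sa:
  fixes F :: "real \<Rightarrow> ('h::chilbert_space \<Rightarrow>\<^sub>L 'h)"
  assumes F: "F integrable_on K" "\<And>s. s \<in> K \<Longrightarrow> F s \<in> BH_sa"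
  shows "integral K F \<in> BH_sa"
proof -
  interpret ci: bounded_bilinear "cinner :: 'h \<Rightarrow> 'h \<Rightarrow> complex" by (rule bounded_bilinear_cinner)
  have ap: "integral K F x = integral K (\<lambda>s. F s x)" for x
    using integral_linear[OF F(1) blinfun.bounded_linear_left[of x]] by (simp add: o_def)
  have "integral K F (c *\<^sub>C x) = c *\<^sub>C integral K F x" for c x
  proof -
    have bl: "bounded_linear (\<lambda>T :: 'h \<Rightarrow>\<^sub>L 'h. c *\<^sub>C blinfun_apply T x)"
      by (rule bounded_linear_compose[OF bounded_linear_scaleC blinfun.bounded_linear_left])
    show ?thesis
      unfolding ap[of "c *\<^sub>C x"]
      using integral_linear[OF F(1) bl] F(2)
      by (simp add: o_def BH_scaleC[OF BH_sa_BH] cong: integral_cong)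
  qed
  moreover have "cinner (integral K F x) y = cinner x (integral K F y)" for x y
  proof -
    have l: "bounded_linear (\<lambda>T :: 'h \<Rightarrow>\<^sub>L 'h. cinner (blinfun_apply T x) y)"
      by (rule bounded_linear_compose[OF ci.bounded_linear_left blinfun.bounded_linear_left])
    have r: "bounded_linear (\<lambda>T :: 'h \<Rightarrow>\<^sub>L 'h. cinner x (blinfun_apply T y))"
      by (rule bounded_linear_compose[OF ci.bounded_linear_right blinfun.bounded_linear_left])
    show ?thesis
      using integral_linear[OF F(1) l] integral_linear[OF F(1) r] BH_sa_cinner[OF F(2)]
      by (simp add: o_def cong: integral_cong)
  qed
  ultimately show ?thesis by (simp add: BH_sa_def BH_def)
qed

text \<open>Both conclusions concern the single operator \<open>X\<close>: its quadratic form is the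
  scalar trapezoid error of \<open>g\<close>, since evaluation at \<open>x\<close> commutes with
  both integrals, and \<open>norm_BH_sa_le\<close> converts the bound on the form into one on the
  norm.\<close>

lemma operator_trapezoid:
  fixes F :: "real \<Rightarrow> ('h::chilbert_space \<Rightarrow>\<^sub>L 'h)"
  assumes cont: "continuous_on {0..1} F"
    and sa: "\<And>s. s \<in> {0..1} \<Longrightarrow> F s \<in> BH_sa"
    and pos: "\<And>s x. s \<in> {0..1} \<Longrightarrow> 0 \<le> Re (cinner (blinfun_apply (F s) x) x)"
    and conv: "\<And>u v t. u \<in> {0..1} \<Longrightarrow> v \<in> {0..1} \<Longrightarrow> t \<in> {0..1} \<Longrightarrow>
      F (u + t * (v - u)) \<le>\<^sub>o\<^sub>p (1 - t) *\<^sub>R F u + t *\<^sub>R F v"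
    and ab: "0 \<le> a" "a < b" "b \<le> 1"
  shows "cmod (1 / 2 * cinner (blinfun_apply (integral {0..a} F) x) x
      + 1 / 2 * cinner (blinfun_apply (integral {0..b} F) x) x
      - complex_of_real (1 / (b - a)) * integral {a..b} (\<lambda>t. cinner (blinfun_apply (integral {0..t} F) x) x))
      \<le> (b - a) / 8 * Re (cinner (blinfun_apply (F a) x) x + cinner (blinfun_apply (F b) x) x)"
    and "norm ((1 / 2) *\<^sub>R integral {0..a} F + (1 / 2) *\<^sub>R integral {0..b} F
        - (1 / (b - a)) *\<^sub>R integral {a..b} (\<lambda>t. integral {0..t} F))
      \<le> (b - a) / 8 * norm (F a + F b)"
proof -
  interpret ci: bounded_bilinear "cinner :: 'h \<Rightarrow> 'h \<Rightarrow> complex" by (rule bounded_bilinear_cinner)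
  define X where "X = (1 / 2) *\<^sub>R integral {0..a} F + (1 / 2) *\<^sub>R integral {0..b} F
        - (1 / (b - a)) *\<^sub>R integral {a..b} (\<lambda>t. integral {0..t} F)"
  have int: "F integrable_on {0..t}" if "t \<le> 1" for t
    by (intro integrable_continuous_interval continuous_on_subset[OF cont]) (use that in auto)
  have contF: "continuous_on {0..1} (\<lambda>t. integral {0..t} F)"
    by (rule indefinite_integral_continuous_1[OF int]) simp
  have int2: "(\<lambda>t. integral {0..t} F) integrable_on {a..b}"
    by (intro integrable_continuous_interval continuous_on_subset[OF contF]) (use ab in auto)
  have bl: "bounded_linear (\<lambda>T :: 'h \<Rightarrow>\<^sub>L 'h. cinner (blinfun_apply T x) x)" for x :: 'h
    by (rule bounded_linear_compose[OF ci.bounded_linear_left blinfun.bounded_linear_left])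
  have EX: "1 / 2 * cinner (integral {0..a} F x) x + 1 / 2 * cinner (integral {0..b} F x) x
      - complex_of_real (1 / (b - a)) * integral {a..b} (\<lambda>t. cinner (integral {0..t} F x) x)
      = cinner (X x) x" for x
    using integral_linear[OF int2 bl[of x]]
    by (simp add: X_def o_def blinfun.add_left blinfun.diff_left blinfun.scaleR_left
        cinner_add_left cinner_diff_left cinner_scaleR_left)
  have num: "cmod (cinner (X x) x) \<le> (b - a) / 8 * Re (cinner (F a x) x + cinner (F b x) x)" for x
  proof -
    define g where "g s = Re (cinner (F s x) x)" for s
    have contg: "continuous_on {0..1} g"
      unfolding g_def by (intro continuous_on_Re bounded_linear.continuous_on[OF bl cont])
    have tr: "cinner (integral {0..t} F x) x = complex_of_real (integral {0..t} g)" if t: "t \<le> 1" for t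
    proof -
      have "cinner (integral {0..t} F x) x = integral {0..t} (\<lambda>s. cinner (F s x) x)"
        using integral_linear[OF int[OF t] bl[of x]] by (simp add: o_def)
      also have "\<dots> = integral {0..t} (\<lambda>s. complex_of_real (g s))"
        by (rule integral_cong) (use cinner_BH_sa_real[OF sa] t in \<open>simp add: g_def\<close>)
      also have "\<dots> = complex_of_real (integral {0..t} g)"
        by (rule integral_linear[OF _ bounded_linear_of_real, unfolded o_def])
          (intro integrable_continuous_interval continuous_on_subset[OF contg], use t in auto)
      finally show ?thesis .
    qed
    have contG: "continuous_on {0..1} (\<lambda>t. integral {0..t} g)"
      by (intro indefinite_integral_continuous_1 integrable_continuous_interval contg)
    have "integral {a..b} (\<lambda>t. cinner (integral {0..t} F x) x)
        = integral {a..b} (\<lambda>t. complex_of_real (integral {0..t} g))"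
      by (rule integral_cong) (use tr ab in auto)
    also have "\<dots> = complex_of_real (integral {a..b} (\<lambda>t. integral {0..t} g))"
      by (rule integral_linear[OF _ bounded_linear_of_real, unfolded o_def])
        (intro integrable_continuous_interval continuous_on_subset[OF contG], use ab in auto)
    finally have "cinner (X x) x = complex_of_real (1 / 2 * integral {0..a} g + 1 / 2 * integral {0..b} g
        - 1 / (b - a) * integral {a..b} (\<lambda>t. integral {0..t} g))"
      unfolding EX[of x, symmetric] using ab by (simp add: tr)
    then have "cmod (cinner (X x) x) = \<bar>1 / 2 * integral {0..a} g + 1 / 2 * integral {0..b} g
        - 1 / (b - a) * integral {a..b} (\<lambda>t. integral {0..t} g)\<bar>"
      by (simp only: norm_of_real)
    also have "\<dots> \<le> (b - a) / 8 * (g a + g b)"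
    proof (rule convex_trapezoid[OF contg _ _ ab])
      show "0 \<le> g s" if "s \<in> {0..1}" for s using pos[OF that] by (simp add: g_def)
      fix u v t :: real assume "u \<in> {0..1}" "v \<in> {0..1}" "t \<in> {0..1}"
      from conv[OF this]
      have "0 \<le> Re (cinner (((1 - t) *\<^sub>R F u + t *\<^sub>R F v - F (u + t * (v - u))) x) x)"
        unfolding op_le_def positive_op_def by (simp add: complex_nonneg_Reals_iff)
      then show "g (u + t * (v - u)) \<le> (1 - t) * g u + t * g v"
        by (simp add: g_def blinfun.add_left blinfun.diff_left blinfun.scaleR_left
            cinner_add_left cinner_diff_left cinner_scaleR_left)
    qed
    finally show ?thesis by (simp add: g_def)
  qed
  then show "cmod (1 / 2 * cinner (integral {0..a} F x) x + 1 / 2 * cinner (integral {0..b} F x) x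
      - complex_of_real (1 / (b - a)) * integral {a..b} (\<lambda>t. cinner (integral {0..t} F x) x))
      \<le> (b - a) / 8 * Re (cinner (F a x) x + cinner (F b x) x)"
    by (simp only: EX)
  have int_sa: "integral {0..t} F \<in> BH_sa" if "t \<le> 1" for t
    by (rule integral_BH_sa[OF int[OF that]]) (use sa that in auto)
  have "integral {a..b} (\<lambda>t. integral {0..t} F) \<in> BH_sa"
    by (rule integral_BH_sa[OF int2]) (use int_sa ab in auto)
  then have "X \<in> BH_sa"
    unfolding X_def using int_sa ab by (intro BH_sa_add BH_sa_diff BH_sa_scaleR) auto
  then have "norm X \<le> (b - a) / 8 * norm (F a + F b)"
  proof (rule norm_BH_sa_le)
    fix x :: 'h assume x: "norm x = 1"
    have "Re (cinner (F a x) x + cinner (F b x) x) = Re (cinner ((F a + F b) x) x)"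
      by (simp add: blinfun.add_left cinner_add_left)
    also have "\<dots> \<le> norm ((F a + F b) x) * norm x"
      using complex_Re_le_cmod cmod_cinner_le order_trans by blast
    also have "\<dots> \<le> norm (F a + F b)" using norm_blinfun[of "F a + F b" x] x by simp
    finally have "(b - a) / 8 * Re (cinner (F a x) x + cinner (F b x) x) \<le> (b - a) / 8 * norm (F a + F b)"
      using ab by (intro mult_left_mono) auto
    then show "\<bar>Re (cinner (X x) x)\<bar> \<le> (b - a) / 8 * norm (F a + F b)"
      using num[of x] abs_Re_le_cmod[of "cinner (X x) x"] by linarith
  qed (use ab in simp)
  then show "norm ((1 / 2) *\<^sub>R integral {0..a} F + (1 / 2) *\<^sub>R integral {0..b} F
        - (1 / (b - a)) *\<^sub>R integral {a..b} (\<lambda>t. integral {0..t} F))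
      \<le> (b - a) / 8 * norm (F a + F b)"
    by (simp only: X_def)
qed


theorem theorem4:
  fixes I :: "real set"
    and f :: "real \<Rightarrow> real"
    and S :: "('h::chilbert_space \<Rightarrow>\<^sub>L 'h) set"
    and \<eta> :: "('h \<Rightarrow>\<^sub>L 'h) \<Rightarrow> ('h \<Rightarrow>\<^sub>L 'h) \<Rightarrow> ('h \<Rightarrow>\<^sub>L 'h)"
  assumes "is_interval I"
    and "continuous_on I f"
    and "\<forall>r\<in>I. 0 \<le> f r"
    and "openin (top_of_set BH_sa) S"
    and "\<forall>X\<in>S. \<forall>Y\<in>S. \<eta> X Y \<in> BH_sa"
    and "invex S \<eta>"
    and "condition_C S \<eta>"
    and "\<forall>A\<in>S. \<forall>B\<in>S.
           spectrum A \<subseteq> complex_of_real ` I \<and>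
           spectrum (A + \<eta> B A) \<subseteq> complex_of_real ` I \<and>
           operator_preinvex I f \<eta> (eta_path \<eta> A B)"
  shows "\<forall>A\<in>S. \<forall>B\<in>S. \<forall>a\<in>{0<..<1}. \<forall>b\<in>{0<..<1}. a < b \<longrightarrow>
    (\<forall>x. norm x = 1 \<longrightarrow>
       cmod (1 / 2 * cinner (blinfun_apply (integral {0..a} (\<lambda>s. fun_op f (A + s *\<^sub>R \<eta> B A))) x) x
           + 1 / 2 * cinner (blinfun_apply (integral {0..b} (\<lambda>s. fun_op f (A + s *\<^sub>R \<eta> B A))) x) x
           - complex_of_real (1 / (b - a)) * integral {a..b} (\<lambda>t.
               cinner (blinfun_apply (integral {0..t} (\<lambda>s. fun_op f (A + s *\<^sub>R \<eta> B A))) x) x))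
       \<le> (b - a) / 8 * Re (cinner (blinfun_apply (fun_op f (A + a *\<^sub>R \<eta> B A)) x) x
                         + cinner (blinfun_apply (fun_op f (A + b *\<^sub>R \<eta> B A)) x) x)) \<and>
    norm ((1 / 2) *\<^sub>R integral {0..a} (\<lambda>s. fun_op f (A + s *\<^sub>R \<eta> B A))
        + (1 / 2) *\<^sub>R integral {0..b} (\<lambda>s. fun_op f (A + s *\<^sub>R \<eta> B A))
        - (1 / (b - a)) *\<^sub>R integral {a..b} (\<lambda>t.
            integral {0..t} (\<lambda>s. fun_op f (A + s *\<^sub>R \<eta> B A))))
      \<le> (b - a) / 8 * norm (fun_op f (A + a *\<^sub>R \<eta> B A) + fun_op f (A + b *\<^sub>R \<eta> B A)) \<and>
    (b - a) / 8 * norm (fun_op f (A + a *\<^sub>R \<eta> B A) + fun_op f (A + b *\<^sub>R \<eta> B A))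
      \<le> (b - a) / 8 * (norm (fun_op f (A + a *\<^sub>R \<eta> B A)) + norm (fun_op f (A + b *\<^sub>R \<eta> B A)))"
proof (intro ballI impI)
  fix A B :: "'h \<Rightarrow>\<^sub>L 'h" and a b :: real
  assume AB: "A \<in> S" "B \<in> S" and "a \<in> {0<..<1}" "b \<in> {0<..<1}" and "a < b"
  then have ab: "0 \<le> a" "a < b" "b \<le> 1" by auto
  let ?P = "\<lambda>s. A + s *\<^sub>R \<eta> B A"
  define F where "F s = fun_op f (?P s)" for s
  have S_sa: "S \<subseteq> BH_sa" using assms(4) by (auto dest: openin_imp_subset)
  then have P_sa: "?P s \<in> BH_sa" for s
    by (intro BH_sa_add BH_sa_scaleR subsetD[OF S_sa AB(1)] assms(5)[rule_format] AB)
  have pre: "operator_preinvex I f \<eta> (eta_path \<eta> A B)" using assms(8) AB by blast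
  have path: "?P s \<in> eta_path \<eta> A B" if "s \<in> {0..1}" for s using that by (auto simp: eta_path_def)
  have spec: "spectrum (?P s) \<subseteq> complex_of_real ` I" if "s \<in> {0..1}" for s
    \<comment> \<open>Parameter 0 reduces the spectral clause to the point \<open>?P s\<close>
      itself.\<close>
    using operator_preinvexD(1)[OF pre path[OF that] path[OF that], of 0] by simp
  have cont: "continuous_on {0..1} F"
    unfolding F_def
    by (rule continuous_on_fun_op[OF _ _ P_sa assms(2) spec]) (auto intro!: continuous_intros)
  have sa: "F s \<in> BH_sa" if "s \<in> {0..1}" for s
    unfolding F_def by (rule fun_op_BH_sa[OF P_sa assms(2) spec[OF that]])
  have pos: "0 \<le> Re (cinner (F s x) x)" if "s \<in> {0..1}" for s x
    unfolding F_def by (rule fun_op_nonneg[OF P_sa assms(2) spec[OF that] assms(3)])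
  have conv: "F (u + t * (v - u)) \<le>\<^sub>o\<^sub>p (1 - t) *\<^sub>R F u + t *\<^sub>R F v"
    if "u \<in> {0..1}" "v \<in> {0..1}" "t \<in> {0..1}" for u v t
  proof -
    have "fun_op f (?P u + t *\<^sub>R \<eta> (?P v) (?P u)) \<le>\<^sub>o\<^sub>p (1 - t) *\<^sub>R fun_op f (?P u) + t *\<^sub>R fun_op f (?P v)"
      by (rule operator_preinvexD(2)[OF pre path[OF that(1)] path[OF that(2)] that(3)])
    moreover have "?P u + t *\<^sub>R \<eta> (?P v) (?P u) = ?P (u + t * (v - u))"
      unfolding condition_C_path[OF assms(7,6) AB that(1,2)] by (simp add: algebra_simps)
    ultimately show ?thesis by (simp only: F_def)
  qed
  note trapezoid = operator_trapezoid[OF cont sa pos conv ab]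
  have "(b - a) / 8 * norm (F a + F b) \<le> (b - a) / 8 * (norm (F a) + norm (F b))"
    using ab by (intro mult_left_mono norm_triangle_ineq) auto
  with trapezoid show "(\<forall>x. norm x = 1 \<longrightarrow>
       cmod (1 / 2 * cinner (blinfun_apply (integral {0..a} (\<lambda>s. fun_op f (A + s *\<^sub>R \<eta> B A))) x) x
           + 1 / 2 * cinner (blinfun_apply (integral {0..b} (\<lambda>s. fun_op f (A + s *\<^sub>R \<eta> B A))) x) x
           - complex_of_real (1 / (b - a)) * integral {a..b} (\<lambda>t.
               cinner (blinfun_apply (integral {0..t} (\<lambda>s. fun_op f (A + s *\<^sub>R \<eta> B A))) x) x))
       \<le> (b - a) / 8 * Re (cinner (blinfun_apply (fun_op f (A + a *\<^sub>R \<eta> B A)) x) x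
                         + cinner (blinfun_apply (fun_op f (A + b *\<^sub>R \<eta> B A)) x) x)) \<and>
    norm ((1 / 2) *\<^sub>R integral {0..a} (\<lambda>s. fun_op f (A + s *\<^sub>R \<eta> B A))
        + (1 / 2) *\<^sub>R integral {0..b} (\<lambda>s. fun_op f (A + s *\<^sub>R \<eta> B A))
        - (1 / (b - a)) *\<^sub>R integral {a..b} (\<lambda>t.
            integral {0..t} (\<lambda>s. fun_op f (A + s *\<^sub>R \<eta> B A))))
      \<le> (b - a) / 8 * norm (fun_op f (A + a *\<^sub>R \<eta> B A) + fun_op f (A + b *\<^sub>R \<eta> B A)) \<and>
    (b - a) / 8 * norm (fun_op f (A + a *\<^sub>R \<eta> B A) + fun_op f (A + b *\<^sub>R \<eta> B A))
      \<le> (b - a) / 8 * (norm (fun_op f (A + a *\<^sub>R \<eta> B A)) + norm (fun_op f (A + b *\<^sub>R \<eta> B A)))"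
    unfolding F_def[abs_def] by blast
qed

end
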